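(* If $\mathbb{X}$ is a generalized differential restriction category, then so is its restriction idempotent splitting $K_r(\mathbb{X})$, with $$L(X,e) := (L(X),1)\quad\text{and}\quad D[f]:=D[f],$$ i.e. $L(X,e)$ is the monoid with underlying object $(L_0(X),1)$, addition $+_X$ and zero $0_X$, and for a map $f:(X,e_1)\to(Y,e_2)$ of $K_r(\mathbb{X})$, the derivative in $K_r(\mathbb{X})$ is the derivative $D[f]:L_0(X)\times X\to L_0(Y)$ of $f$ in $\mathbb{X}$, regarded as a map $(L_0(X)\times X,1\times e_1)\to(L_0(Y),1)$.
   Context: Composition is diagrammatic: $fg$ means first $f$, then $g$. A restriction category is a category with an operation assigning to each $f:X\to Y$ a map $\overline{f}:X\to X$ with: [R.1] $\overline{f}f=f$; [R.2] $\overline{f}\,\overline{g}=\overline{g}\,\overline{f}$ for $f,g$ with the same domain; [R.3] $\overline{\overline{f}g}=\overline{f}\,\overline{g}$ for $f,g$ with the same domain; [R.4] $f\overline{g}=\overline{fg}f$. A map $f$ is total if $\overline{f}=1$. A restriction idempotent is a map $e$ with $e=\overline{e}$. A Cartesian restriction category is a restriction category with chosen restriction products: a chosen object $1$ with, for each $X$, a unique total map $!:X\to1$, such that every $f:X\to1$ equals $\overline{f}\,!$; and for all $X,Y$ a chosen object $X\times Y$ with total projections $\pi_0,\pi_1$ such that for all $f:Z\to X$, $g:Z\to Y$ there is a unique $\langle f,g\rangle:Z\to X\times Y$ with $\langle f,g\rangle\pi_0=\overline{g}f$ and $\langle f,g\rangle\pi_1=\overline{f}g$. For a total commutative monoid $(A,+_A,0_A)$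 (commutative monoid whose structure maps $+_A:A\times A\to A$, $0_A:1\to A$ are total) and $f,g:X\to A$, $f+g:=\langle f,g\rangle+_A$ and $0:X\to A$ denotes $!\,0_A$. A generalized differential restriction category is a Cartesian restriction category with: for each object $X$, a total commutative monoid $L(X)=(L_0(X),+_X,0_X)$ with $L(L_0(X))=L(X)$, $L(X\times Y)=L(X)\times L(Y)$ (product monoid) and $L(1)=1$; and for each map $f:X\to Y$ a map $D[f]:L_0(X)\times X\to L_0(Y)$ such that (for all well-typed maps): [DR.1] $D[+_X]=\pi_0+_X$ and $D[0_X]=\pi_00_X$; [DR.2] $\langle a+b,c\rangle D[f]=\langle a,c\rangle D[f]+\langle b,c\rangle D[f]$ and $\langle0,a\rangle D[f]=\overline{af}\,0$; [DR.3] $D[\pi_0]=\pi_0\pi_0$ and $D[\pi_1]=\pi_0\pi_1$; [DR.4] $D[\langle f,g\rangle]=\langle D[f],D[g]\rangle$; [DR.5] $D[fg]=\langle D[f],\pi_1f\rangle D[g]$; [DR.6] $\langle\langle a,0\rangle,\langle c,d\rangle\rangle D[D[f]]=\overline{c}\,\langle a,d\rangle D[f]$; [DR.7] $\langle\langle0,b\rangle,\langle c,d\rangle\rangle D[D[f]]=\langle\langle0,c\rangle,\langle b,d\rangle\rangle D[D[f]]$; [DR.8] $D[\overline{f}]=(1\times\overline{f})\pi_0=\overline{\pi_1f}\,\pi_0$; [DR.9] $\overline{D[f]}=1\times\overline{f}=\overline{\pi_1f}$. $K_r(\mathbb{X})$ is the restriction category whose objects are pairs $(X,e)$ with $e=\overline{e}:X\to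 X$ a restriction idempotent of $\mathbb{X}$; a map $f:(X,e_1)\to(Y,e_2)$ is a map $f:X\to Y$ of $\mathbb{X}$ with $e_1fe_2=f$; composition and restriction are as in $\mathbb{X}$, and $1_{(X,e)}=e$. Its chosen restriction products are $(X,e)\times(Y,e')=(X\times Y,e\times e')$ with projections $(e\times e')\pi_i$, and its restriction terminal object is $(1,1)$. *)

theory Defs
  imports Main
begin

text \<open>
  Categories are given by their data (sets of objects and arrows, and total HOL functions for
  domain, codomain, identities and composition); the laws are only required on the objects and
  arrows of the category and on well-typed composites, the functions being unconstrained elsewhere.
  Composition is diagrammatic: \<open>f \<cdot> g\<close> is first \<open>f\<close>, then \<open>g\<close>.
\<close>

record ('o, 'a) restr_cat =
  Obj :: "'o set"
  Arr :: "'a set"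
  Dom :: "'a \<Rightarrow> 'o"
  Cod :: "'a \<Rightarrow> 'o"
  idt :: "'o \<Rightarrow> 'a"  ("\<iota>\<index>")
  comp :: "'a \<Rightarrow> 'a \<Rightarrow> 'a"  (infixl "\<cdot>\<index>" 70)
  rst :: "'a \<Rightarrow> 'a"  ("\<rho>\<index>")

definition hom :: "('o, 'a, 'm) restr_cat_scheme \<Rightarrow> 'o \<Rightarrow> 'o \<Rightarrow> 'a set" where
  "hom C X Y = {f \<in> Arr C. Dom C f = X \<and> Cod C f = Y}"

definition total :: "('o, 'a, 'm) restr_cat_scheme \<Rightarrow> 'a \<Rightarrow> bool" where
  "total C f \<longleftrightarrow> rst C f = idt C (Dom C f)"

locale restriction_category =
  fixes C :: "('o, 'a, 'm) restr_cat_scheme" (structure)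
  assumes Dom_Obj: "f \<in> Arr C \<Longrightarrow> Dom C f \<in> Obj C"
    and Cod_Obj: "f \<in> Arr C \<Longrightarrow> Cod C f \<in> Obj C"
    and idt_hom: "X \<in> Obj C \<Longrightarrow> \<iota> X \<in> hom C X X"
    and comp_hom: "\<lbrakk>f \<in> hom C X Y; g \<in> hom C Y Z\<rbrakk> \<Longrightarrow> f \<cdot> g \<in> hom C X Z"
    and idt_left: "f \<in> hom C X Y \<Longrightarrow> \<iota> X \<cdot> f = f"
    and idt_right: "f \<in> hom C X Y \<Longrightarrow> f \<cdot> \<iota> Y = f"
    and comp_assoc: "\<lbrakk>f \<in> hom C W X; g \<in> hom C X Y; h \<in> hom C Y Z\<rbrakk>
          \<Longrightarrow> (f \<cdot> g) \<cdot> h = f \<cdot> (g \<cdot> h)"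
    and rst_hom: "f \<in> hom C X Y \<Longrightarrow> \<rho> f \<in> hom C X X"
    and R1: "f \<in> hom C X Y \<Longrightarrow> \<rho> f \<cdot> f = f"
    and R2: "\<lbrakk>f \<in> hom C X Y; g \<in> hom C X Z\<rbrakk> \<Longrightarrow> \<rho> f \<cdot> \<rho> g = \<rho> g \<cdot> \<rho> f"
    and R3: "\<lbrakk>f \<in> hom C X Y; g \<in> hom C X Z\<rbrakk> \<Longrightarrow> \<rho> (\<rho> f \<cdot> g) = \<rho> f \<cdot> \<rho> g"
    and R4: "\<lbrakk>f \<in> hom C X Y; g \<in> hom C Y Z\<rbrakk> \<Longrightarrow> f \<cdot> \<rho> g = \<rho> (f \<cdot> g) \<cdot> f"

record ('o, 'a) cart_restr_cat = "('o, 'a) restr_cat" +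
  unit_obj :: "'o"  ("\<one>\<index>")
  prod_obj :: "'o \<Rightarrow> 'o \<Rightarrow> 'o"  (infixr "\<otimes>\<index>" 75)
  proj0 :: "'o \<Rightarrow> 'o \<Rightarrow> 'a"  ("\<pi>0\<index>")
  proj1 :: "'o \<Rightarrow> 'o \<Rightarrow> 'a"  ("\<pi>1\<index>")

text \<open>
  The objects and the projections are chosen; the maps to the terminal object and the pairings
  are determined by their universal properties.
\<close>

definition bang :: "('o, 'a, 'm) cart_restr_cat_scheme \<Rightarrow> 'o \<Rightarrow> 'a"  ("\<tau>\<index>") where
  "bang C X = (THE t. t \<in> hom C X (unit_obj C) \<and> total C t)"

definition is_pairing :: "('o, 'a, 'm) cart_restr_cat_scheme \<Rightarrow> 'a \<Rightarrow> 'a \<Rightarrow> 'a \<Rightarrow> bool" where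
  "is_pairing C f g h \<longleftrightarrow>
     h \<in> hom C (Dom C f) (prod_obj C (Cod C f) (Cod C g)) \<and>
     comp C h (proj0 C (Cod C f) (Cod C g)) = comp C (rst C g) f \<and>
     comp C h (proj1 C (Cod C f) (Cod C g)) = comp C (rst C f) g"

definition pairing :: "('o, 'a, 'm) cart_restr_cat_scheme \<Rightarrow> 'a \<Rightarrow> 'a \<Rightarrow> 'a"  ("\<langle>_,/ _\<rangle>\<index>") where
  "pairing C f g = (THE h. is_pairing C f g h)"

definition prod_map :: "('o, 'a, 'm) cart_restr_cat_scheme \<Rightarrow> 'a \<Rightarrow> 'a \<Rightarrow> 'a"  (infixr "\<odot>\<index>" 75) where
  "prod_map C f g = pairing C (comp C (proj0 C (Dom C f) (Dom C g)) f)
                              (comp C (proj1 C (Dom C f) (Dom C g)) g)"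

locale cartesian_restriction_category = restriction_category C
  for C :: "('o, 'a, 'm) cart_restr_cat_scheme" (structure) +
  assumes unit_Obj: "\<one> \<in> Obj C"
    and bang_ex1: "X \<in> Obj C \<Longrightarrow> \<exists>!t. t \<in> hom C X \<one> \<and> total C t"
    and bang_rst: "f \<in> hom C X \<one> \<Longrightarrow> f = \<rho> f \<cdot> \<tau> X"
    and prod_Obj: "\<lbrakk>X \<in> Obj C; Y \<in> Obj C\<rbrakk> \<Longrightarrow> X \<otimes> Y \<in> Obj C"
    and proj0_hom: "\<lbrakk>X \<in> Obj C; Y \<in> Obj C\<rbrakk> \<Longrightarrow> \<pi>0 X Y \<in> hom C (X \<otimes> Y) X"
    and proj1_hom: "\<lbrakk>X \<in> Obj C; Y \<in> Obj C\<rbrakk> \<Longrightarrow> \<pi>1 X Y \<in> hom C (X \<otimes> Y) Y"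
    and proj0_total: "\<lbrakk>X \<in> Obj C; Y \<in> Obj C\<rbrakk> \<Longrightarrow> total C (\<pi>0 X Y)"
    and proj1_total: "\<lbrakk>X \<in> Obj C; Y \<in> Obj C\<rbrakk> \<Longrightarrow> total C (\<pi>1 X Y)"
    and pairing_ex1: "\<lbrakk>f \<in> hom C Z X; g \<in> hom C Z Y\<rbrakk> \<Longrightarrow> \<exists>!h. is_pairing C f g h"

locale total_commutative_monoid = cartesian_restriction_category C
  for C :: "('o, 'a, 'm) cart_restr_cat_scheme" (structure) +
  fixes A :: 'o and add zero :: 'a
  assumes carrier_Obj: "A \<in> Obj C"
    and add_hom: "add \<in> hom C (A \<otimes> A) A"
    and zero_hom: "zero \<in> hom C \<one> A"
    and add_total: "total C add"
    and zero_total: "total C zero"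
    and add_assoc: "(add \<odot> \<iota> A) \<cdot> add =
          \<langle>\<pi>0 (A \<otimes> A) A \<cdot> \<pi>0 A A, \<langle>\<pi>0 (A \<otimes> A) A \<cdot> \<pi>1 A A, \<pi>1 (A \<otimes> A) A\<rangle>\<rangle>
            \<cdot> (\<iota> A \<odot> add) \<cdot> add"
    and zero_left: "\<langle>\<tau> A \<cdot> zero, \<iota> A\<rangle> \<cdot> add = \<iota> A"
    and zero_right: "\<langle>\<iota> A, \<tau> A \<cdot> zero\<rangle> \<cdot> add = \<iota> A"
    and add_commute: "\<langle>\<pi>1 A A, \<pi>0 A A\<rangle> \<cdot> add = add"

record ('o, 'a) gen_diff_restr_cat = "('o, 'a) cart_restr_cat" +
  Lobj :: "'o \<Rightarrow> 'o"  ("L0\<index>")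
  Ladd :: "'o \<Rightarrow> 'a"  ("\<alpha>\<index>")
  Lzero :: "'o \<Rightarrow> 'a"  ("\<zeta>\<index>")
  diff :: "'a \<Rightarrow> 'a"  ("\<partial>\<index>")

text \<open>
  \<open>\<alpha> X : L0 X \<otimes> L0 X \<rightarrow> L0 X\<close> and \<open>\<zeta> X : \<one> \<rightarrow> L0 X\<close> are the
  addition and the zero of the monoid \<open>L(X)\<close>. \<open>addL C X f g\<close> is the sum \<open>f + g\<close> of two maps
  into \<open>L0 X\<close>, and \<open>zeroL C W X\<close> is the map \<open>0\<close> from \<open>W\<close> to \<open>L0 X\<close>.
\<close>

definition addL :: "('o, 'a, 'm) gen_diff_restr_cat_scheme \<Rightarrow> 'o \<Rightarrow> 'a \<Rightarrow> 'a \<Rightarrow> 'a" where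
  "addL C X f g = comp C (pairing C f g) (Ladd C X)"

definition zeroL :: "('o, 'a, 'm) gen_diff_restr_cat_scheme \<Rightarrow> 'o \<Rightarrow> 'o \<Rightarrow> 'a" where
  "zeroL C W X = comp C (bang C W) (Lzero C X)"

locale generalized_differential_restriction_category = cartesian_restriction_category C
  for C :: "('o, 'a, 'm) gen_diff_restr_cat_scheme" (structure) +
  assumes L_monoid: "X \<in> Obj C \<Longrightarrow> total_commutative_monoid C (L0 X) (\<alpha> X) (\<zeta> X)"
    and L0_L0: "X \<in> Obj C \<Longrightarrow> L0 (L0 X) = L0 X"
    and Ladd_L0: "X \<in> Obj C \<Longrightarrow> \<alpha> (L0 X) = \<alpha> X"
    and Lzero_L0: "X \<in> Obj C \<Longrightarrow> \<zeta> (L0 X) = \<zeta> X"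
    and L0_prod: "\<lbrakk>X \<in> Obj C; Y \<in> Obj C\<rbrakk> \<Longrightarrow> L0 (X \<otimes> Y) = L0 X \<otimes> L0 Y"
    and Ladd_prod: "\<lbrakk>X \<in> Obj C; Y \<in> Obj C\<rbrakk> \<Longrightarrow> \<alpha> (X \<otimes> Y) =
          \<langle>(\<pi>0 (L0 X) (L0 Y) \<odot> \<pi>0 (L0 X) (L0 Y)) \<cdot> \<alpha> X,
           (\<pi>1 (L0 X) (L0 Y) \<odot> \<pi>1 (L0 X) (L0 Y)) \<cdot> \<alpha> Y\<rangle>"
    and Lzero_prod: "\<lbrakk>X \<in> Obj C; Y \<in> Obj C\<rbrakk> \<Longrightarrow> \<zeta> (X \<otimes> Y) = \<langle>\<zeta> X, \<zeta> Y\<rangle>"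
    and L0_unit: "L0 \<one> = \<one>"
    and Ladd_unit: "\<alpha> \<one> = \<tau> (\<one> \<otimes> \<one>)"
    and Lzero_unit: "\<zeta> \<one> = \<tau> \<one>"
    and diff_hom: "f \<in> hom C X Y \<Longrightarrow> \<partial> f \<in> hom C (L0 X \<otimes> X) (L0 Y)"
    and DR1_add: "X \<in> Obj C \<Longrightarrow>
          \<partial> (\<alpha> X) = \<pi>0 (L0 (L0 X \<otimes> L0 X)) (L0 X \<otimes> L0 X) \<cdot> \<alpha> X"
    and DR1_zero: "X \<in> Obj C \<Longrightarrow> \<partial> (\<zeta> X) = \<pi>0 (L0 \<one>) \<one> \<cdot> \<zeta> X"
    and DR2_add: "\<lbrakk>f \<in> hom C X Y; a \<in> hom C Z (L0 X); b \<in> hom C Z (L0 X); c \<in> hom C Z X\<rbrakk> \<Longrightarrow>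
          \<langle>addL C X a b, c\<rangle> \<cdot> \<partial> f = addL C Y (\<langle>a, c\<rangle> \<cdot> \<partial> f) (\<langle>b, c\<rangle> \<cdot> \<partial> f)"
    and DR2_zero: "\<lbrakk>f \<in> hom C X Y; a \<in> hom C Z X\<rbrakk> \<Longrightarrow>
          \<langle>zeroL C Z X, a\<rangle> \<cdot> \<partial> f = \<rho> (a \<cdot> f) \<cdot> zeroL C Z Y"
    and DR3_0: "\<lbrakk>X \<in> Obj C; Y \<in> Obj C\<rbrakk> \<Longrightarrow>
          \<partial> (\<pi>0 X Y) = \<pi>0 (L0 (X \<otimes> Y)) (X \<otimes> Y) \<cdot> \<pi>0 (L0 X) (L0 Y)"
    and DR3_1: "\<lbrakk>X \<in> Obj C; Y \<in> Obj C\<rbrakk> \<Longrightarrow>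
          \<partial> (\<pi>1 X Y) = \<pi>0 (L0 (X \<otimes> Y)) (X \<otimes> Y) \<cdot> \<pi>1 (L0 X) (L0 Y)"
    and DR4: "\<lbrakk>f \<in> hom C Z X; g \<in> hom C Z Y\<rbrakk> \<Longrightarrow> \<partial> \<langle>f, g\<rangle> = \<langle>\<partial> f, \<partial> g\<rangle>"
    and DR5: "\<lbrakk>f \<in> hom C X Y; g \<in> hom C Y Z\<rbrakk> \<Longrightarrow>
          \<partial> (f \<cdot> g) = \<langle>\<partial> f, \<pi>1 (L0 X) X \<cdot> f\<rangle> \<cdot> \<partial> g"
    and DR6: "\<lbrakk>f \<in> hom C X Y; a \<in> hom C W (L0 X); c \<in> hom C W (L0 X); d \<in> hom C W X\<rbrakk> \<Longrightarrow>
          \<langle>\<langle>a, zeroL C W X\<rangle>, \<langle>c, d\<rangle>\<rangle> \<cdot> \<partial> (\<partial> f) = \<rho> c \<cdot> (\<langle>a, d\<rangle> \<cdot> \<partial> f)"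
    and DR7: "\<lbrakk>f \<in> hom C X Y; b \<in> hom C W (L0 X); c \<in> hom C W (L0 X); d \<in> hom C W X\<rbrakk> \<Longrightarrow>
          \<langle>\<langle>zeroL C W X, b\<rangle>, \<langle>c, d\<rangle>\<rangle> \<cdot> \<partial> (\<partial> f) =
          \<langle>\<langle>zeroL C W X, c\<rangle>, \<langle>b, d\<rangle>\<rangle> \<cdot> \<partial> (\<partial> f)"
    and DR8: "f \<in> hom C X Y \<Longrightarrow> \<partial> (\<rho> f) = (\<iota> (L0 X) \<odot> \<rho> f) \<cdot> \<pi>0 (L0 X) X"
    and DR8': "f \<in> hom C X Y \<Longrightarrow> \<partial> (\<rho> f) = \<rho> (\<pi>1 (L0 X) X \<cdot> f) \<cdot> \<pi>0 (L0 X) X"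
    and DR9: "f \<in> hom C X Y \<Longrightarrow> \<rho> (\<partial> f) = \<iota> (L0 X) \<odot> \<rho> f"
    and DR9': "f \<in> hom C X Y \<Longrightarrow> \<rho> (\<partial> f) = \<rho> (\<pi>1 (L0 X) X \<cdot> f)"

text \<open>
  In DR6 and DR7 the zero in the first component lands in the carrier of \<open>L(L0 X)\<close> and the
  zero in the second component lands in the carrier of \<open>L(X)\<close>; these monoids coincide by
  \<open>L0_L0\<close>, \<open>Ladd_L0\<close>, \<open>Lzero_L0\<close>, so both are written \<open>zeroL C W X\<close>.
\<close>

definition restriction_idempotent :: "('o, 'a, 'm) restr_cat_scheme \<Rightarrow> 'o \<Rightarrow> 'a \<Rightarrow> bool" where
  "restriction_idempotent C X e \<longleftrightarrow> e \<in> hom C X X \<and> e = rst C e"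

text \<open>
  The same map \<open>f\<close> of \<open>C\<close> may be a map of the splitting between several pairs of objects, so an
  arrow of the splitting is a triple \<open>((X, e1), f, (Y, e2))\<close> recording its domain and codomain.
\<close>

definition Kr :: "('o, 'a) gen_diff_restr_cat
    \<Rightarrow> ('o \<times> 'a, ('o \<times> 'a) \<times> 'a \<times> ('o \<times> 'a)) gen_diff_restr_cat" where
  "Kr C = \<lparr>
     Obj = {(X, e). X \<in> Obj C \<and> restriction_idempotent C X e},
     Arr = {((X, e1), f, (Y, e2)) | X e1 f Y e2.
              X \<in> Obj C \<and> restriction_idempotent C X e1 \<and>
              Y \<in> Obj C \<and> restriction_idempotent C Y e2 \<and>
              f \<in> hom C X Y \<and> e1 \<cdot>\<^bsub>C\<^esub> f \<cdot>\<^bsub>C\<^esub> e2 = f},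
     Dom = (\<lambda>(A, f, B). A),
     Cod = (\<lambda>(A, f, B). B),
     idt = (\<lambda>(X, e). ((X, e), e, (X, e))),
     comp = (\<lambda>(A, f, B) (B', g, E). (A, f \<cdot>\<^bsub>C\<^esub> g, E)),
     rst = (\<lambda>(A, f, B). (A, \<rho>\<^bsub>C\<^esub> f, A)),
     unit_obj = (\<one>\<^bsub>C\<^esub>, \<iota>\<^bsub>C\<^esub> \<one>\<^bsub>C\<^esub>),
     prod_obj = (\<lambda>(X, e) (Y, e'). (X \<otimes>\<^bsub>C\<^esub> Y, e \<odot>\<^bsub>C\<^esub> e')),
     proj0 = (\<lambda>(X, e) (Y, e').
       ((X \<otimes>\<^bsub>C\<^esub> Y, e \<odot>\<^bsub>C\<^esub> e'), (e \<odot>\<^bsub>C\<^esub> e') \<cdot>\<^bsub>C\<^esub> \<pi>0\<^bsub>C\<^esub> X Y, (X, e))),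
     proj1 = (\<lambda>(X, e) (Y, e').
       ((X \<otimes>\<^bsub>C\<^esub> Y, e \<odot>\<^bsub>C\<^esub> e'), (e \<odot>\<^bsub>C\<^esub> e') \<cdot>\<^bsub>C\<^esub> \<pi>1\<^bsub>C\<^esub> X Y, (Y, e'))),
     Lobj = (\<lambda>(X, e). (L0\<^bsub>C\<^esub> X, \<iota>\<^bsub>C\<^esub> (L0\<^bsub>C\<^esub> X))),
     Ladd = (\<lambda>(X, e).
       ((L0\<^bsub>C\<^esub> X \<otimes>\<^bsub>C\<^esub> L0\<^bsub>C\<^esub> X, \<iota>\<^bsub>C\<^esub> (L0\<^bsub>C\<^esub> X) \<odot>\<^bsub>C\<^esub> \<iota>\<^bsub>C\<^esub> (L0\<^bsub>C\<^esub> X)),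
        \<alpha>\<^bsub>C\<^esub> X, (L0\<^bsub>C\<^esub> X, \<iota>\<^bsub>C\<^esub> (L0\<^bsub>C\<^esub> X)))),
     Lzero = (\<lambda>(X, e).
       ((\<one>\<^bsub>C\<^esub>, \<iota>\<^bsub>C\<^esub> \<one>\<^bsub>C\<^esub>), \<zeta>\<^bsub>C\<^esub> X, (L0\<^bsub>C\<^esub> X, \<iota>\<^bsub>C\<^esub> (L0\<^bsub>C\<^esub> X)))),
     diff = (\<lambda>((X, e1), f, (Y, e2)).
       ((L0\<^bsub>C\<^esub> X \<otimes>\<^bsub>C\<^esub> X, \<iota>\<^bsub>C\<^esub> (L0\<^bsub>C\<^esub> X) \<odot>\<^bsub>C\<^esub> e1),
        \<partial>\<^bsub>C\<^esub> f, (L0\<^bsub>C\<^esub> Y, \<iota>\<^bsub>C\<^esub> (L0\<^bsub>C\<^esub> Y))))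
   \<rparr>"

end

theory Submission
  imports Defs
begin

text \<open>
  Pairings in the splitting are those of \<open>C\<close>: if \<open>f\<close> and \<open>g\<close> are fixed by the idempotents of
  their codomains then so is \<open>\<langle>f, g\<rangle>\<close>. The remaining structure maps (projections, \<open>!\<close>, and hence
  \<open>0\<close>) are those of \<open>C\<close> precomposed with the idempotent of the domain, and that idempotent is
  absorbed wherever an axiom pairs such a map with a map of the splitting. The derivative
  \<open>D[f]\<close> is a map of the splitting because its restriction is the restriction of \<open>\<pi>\<^sub>1 f\<close> (DR.9),
  and DR.3 holds because DR.5 and DR.8 give \<open>D[e f] = (1 \<times> e) D[f]\<close> for every restriction
  idempotent \<open>e\<close>; every other axiom restricts to the one in \<open>C\<close>.
\<close>

section \<open>Restriction categories\<close>

text \<open>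
  The laws are restated with \<open>Dom\<close> and \<open>Cod\<close> instead of \<open>hom\<close>: \<open>comp_hom\<close> mentions an intermediate
  object that the simplifier cannot guess.
\<close>

context restriction_category
begin

lemma hom_iff: "f \<in> hom C X Y \<longleftrightarrow> f \<in> Arr C \<and> Dom C f = X \<and> Cod C f = Y"
  by (simp add: hom_def)

lemma Dom_in_Obj [simp]: "f \<in> Arr C \<Longrightarrow> Dom C f \<in> Obj C"
  and Cod_in_Obj [simp]: "f \<in> Arr C \<Longrightarrow> Cod C f \<in> Obj C"
  by (simp_all add: Dom_Obj Cod_Obj)

lemma idt_arr [simp]:
  assumes "X \<in> Obj C"
  shows "\<iota> X \<in> Arr C" "Dom C (\<iota> X) = X" "Cod C (\<iota> X) = X"
  using idt_hom [OF assms] by (simp_all add: hom_iff)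

lemma comp_arr [simp]:
  assumes "f \<in> Arr C" "g \<in> Arr C" "Cod C f = Dom C g"
  shows "f \<cdot> g \<in> Arr C" "Dom C (f \<cdot> g) = Dom C f" "Cod C (f \<cdot> g) = Cod C g"
  using comp_hom [of f _ _ g] assms by (simp_all add: hom_iff)

lemma rst_arr [simp]:
  assumes "f \<in> Arr C"
  shows "\<rho> f \<in> Arr C" "Dom C (\<rho> f) = Dom C f" "Cod C (\<rho> f) = Dom C f"
  using rst_hom [of f] assms by (simp_all add: hom_iff)

lemma comp_idt_left [simp]: "\<lbrakk>f \<in> Arr C; Dom C f = X\<rbrakk> \<Longrightarrow> \<iota> X \<cdot> f = f"
  and comp_idt_right [simp]: "\<lbrakk>f \<in> Arr C; Cod C f = X\<rbrakk> \<Longrightarrow> f \<cdot> \<iota> X = f"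
  using idt_left [of f X] idt_right [of f _ X] by (simp_all add: hom_iff)

lemma comp_assoc' [simp]:
  "\<lbrakk>f \<in> Arr C; g \<in> Arr C; h \<in> Arr C; Cod C f = Dom C g; Cod C g = Dom C h\<rbrakk>
    \<Longrightarrow> (f \<cdot> g) \<cdot> h = f \<cdot> (g \<cdot> h)"
  using comp_assoc by (simp add: hom_iff)

lemma rst_comp_self [simp]: "f \<in> Arr C \<Longrightarrow> \<rho> f \<cdot> f = f"
  using R1 by (simp add: hom_iff)

lemma rst_commute:
  "\<lbrakk>f \<in> Arr C; g \<in> Arr C; Dom C f = Dom C g\<rbrakk> \<Longrightarrow> \<rho> f \<cdot> \<rho> g = \<rho> g \<cdot> \<rho> f"
  using R2 by (simp add: hom_iff)

lemma rst_rst_comp [simp]: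
  "\<lbrakk>f \<in> Arr C; g \<in> Arr C; Dom C f = Dom C g\<rbrakk> \<Longrightarrow> \<rho> (\<rho> f \<cdot> g) = \<rho> f \<cdot> \<rho> g"
  using R3 by (simp add: hom_iff)

lemma comp_rst:
  "\<lbrakk>f \<in> Arr C; g \<in> Arr C; Cod C f = Dom C g\<rbrakk> \<Longrightarrow> f \<cdot> \<rho> g = \<rho> (f \<cdot> g) \<cdot> f"
  using R4 by (simp add: hom_iff)

section \<open>Derived laws of restriction\<close>

lemma rst_idt [simp]: "X \<in> Obj C \<Longrightarrow> \<rho> (\<iota> X) = \<iota> X"
  using rst_comp_self [of "\<iota> X"] by (simp del: rst_comp_self)

text \<open>This is [R.3] with an identity as the second map.\<close>

lemma rst_rst [simp]: "f \<in> Arr C \<Longrightarrow> \<rho> (\<rho> f) = \<rho> f"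
  using rst_rst_comp [of f "\<iota> (Dom C f)"] by (simp del: rst_rst_comp)

lemma rst_idem [simp]: "f \<in> Arr C \<Longrightarrow> \<rho> f \<cdot> \<rho> f = \<rho> f"
  using rst_comp_self [of "\<rho> f"] by (simp del: rst_comp_self)

lemma rst_left_commute:
  assumes "f \<in> Arr C" "g \<in> Arr C" "h \<in> Arr C" "Dom C f = Dom C g" "Dom C g = Dom C h"
  shows "\<rho> f \<cdot> (\<rho> g \<cdot> h) = \<rho> g \<cdot> (\<rho> f \<cdot> h)"
  using assms comp_assoc' [of "\<rho> f" "\<rho> g" h] comp_assoc' [of "\<rho> g" "\<rho> f" h]
  by (simp add: rst_commute [of f g] del: comp_assoc')

lemma rst_left_idem [simp]:
  assumes "f \<in> Arr C" "h \<in> Arr C" "Dom C f = Dom C h"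
  shows "\<rho> f \<cdot> (\<rho> f \<cdot> h) = \<rho> f \<cdot> h"
  using assms comp_assoc' [of "\<rho> f" "\<rho> f" h] by (simp del: comp_assoc')

text \<open>Reading [R.3] backwards, the left side is the restriction of
  \<open>\<rho> f \<cdot> (f \<cdot> g)\<close>, which [R.1] reduces to
  \<open>f \<cdot> g\<close>.\<close>

lemma rst_absorb:
  assumes "f \<in> Arr C" "g \<in> Arr C" "Cod C f = Dom C g"
  shows "\<rho> f \<cdot> \<rho> (f \<cdot> g) = \<rho> (f \<cdot> g)"
  using assms rst_rst_comp [of f "f \<cdot> g"] comp_assoc' [of "\<rho> f" f g]
  by (simp del: comp_assoc' rst_rst_comp)

text \<open>By [R.4] and [R.3] the left side is
  \<open>\<rho> (f \<cdot> g) \<cdot> \<rho> f\<close>, and the second factor is absorbed by the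
  first. Taking \<open>g\<close> total yields
  \<open>\<rho> (f \<cdot> g) = \<rho> f\<close>.\<close>

lemma rst_comp_rst [simp]:
  assumes "f \<in> Arr C" "g \<in> Arr C" "Cod C f = Dom C g"
  shows "\<rho> (f \<cdot> \<rho> g) = \<rho> (f \<cdot> g)"
  using assms rst_absorb [of f g] rst_commute [of f "f \<cdot> g"] by (simp add: comp_rst [of f g])

lemma rst_comp_total [simp]:
  assumes "f \<in> Arr C" "g \<in> Arr C" "Cod C f = Dom C g" "\<rho> g = \<iota> (Dom C g)"
  shows "\<rho> (f \<cdot> g) = \<rho> f"
  using assms rst_comp_rst [of f g] by (simp del: rst_comp_rst)

section \<open>Restriction idempotents\<close>

lemma restriction_idempotent_iff:
  "restriction_idempotent C X e \<longleftrightarrow> e \<in> Arr C \<and> Dom C e = X \<and> Cod C e = X \<and> \<rho> e = e"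
  by (auto simp: restriction_idempotent_def hom_iff)

lemma restriction_idempotent_comp_self:
  "restriction_idempotent C X e \<Longrightarrow> e \<cdot> e = e"
  using rst_idem [of e] by (simp add: restriction_idempotent_iff del: rst_idem)

end

section \<open>Pairings in Cartesian restriction categories\<close>

context cartesian_restriction_category
begin

declare unit_Obj [simp] prod_Obj [simp]

section \<open>Projections, terminal maps and the universal property of pairings\<close>

lemma proj_arr [simp]:
  assumes "X \<in> Obj C" "Y \<in> Obj C"
  shows "\<pi>0 X Y \<in> Arr C" "Dom C (\<pi>0 X Y) = X \<otimes> Y" "Cod C (\<pi>0 X Y) = X"
    and "\<pi>1 X Y \<in> Arr C" "Dom C (\<pi>1 X Y) = X \<otimes> Y" "Cod C (\<pi>1 X Y) = Y"
  using proj0_hom [OF assms] proj1_hom [OF assms] by (simp_all add: hom_iff)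

lemma rst_proj [simp]:
  assumes "X \<in> Obj C" "Y \<in> Obj C"
  shows "\<rho> (\<pi>0 X Y) = \<iota> (X \<otimes> Y)" "\<rho> (\<pi>1 X Y) = \<iota> (X \<otimes> Y)"
  using proj0_total [OF assms] proj1_total [OF assms] assms by (simp_all add: total_def)

lemma bang_arr [simp]:
  assumes "X \<in> Obj C"
  shows "\<tau> X \<in> Arr C" "Dom C (\<tau> X) = X" "Cod C (\<tau> X) = \<one>" "\<rho> (\<tau> X) = \<iota> X"
  using theI' [OF bang_ex1 [OF assms], folded bang_def] by (auto simp: hom_iff total_def)

lemma to_unit_eq: "\<lbrakk>f \<in> Arr C; Cod C f = \<one>\<rbrakk> \<Longrightarrow> f = \<rho> f \<cdot> \<tau> (Dom C f)"
  using bang_rst [of f "Dom C f"] by (simp add: hom_iff)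

lemma is_pairing_pairing:
  assumes "f \<in> Arr C" "g \<in> Arr C" "Dom C f = Dom C g"
  shows "is_pairing C f g \<langle>f, g\<rangle>"
  using theI' [OF pairing_ex1 [of f "Dom C f" "Cod C f" g "Cod C g"]] assms
  by (simp add: hom_iff pairing_def)

lemma pairing_eqI:
  assumes "f \<in> Arr C" "g \<in> Arr C" "Dom C f = Dom C g" "is_pairing C f g h"
  shows "\<langle>f, g\<rangle> = h"
  using pairing_ex1 [of f "Dom C f" "Cod C f" g "Cod C g"] assms is_pairing_pairing [of f g]
  by (auto simp: hom_iff)

lemma pairing_arr [simp]:
  assumes "f \<in> Arr C" "g \<in> Arr C" "Dom C f = Dom C g"
  shows "\<langle>f, g\<rangle> \<in> Arr C" "Dom C \<langle>f, g\<rangle> = Dom C g" "Cod C \<langle>f, g\<rangle> = Cod C f \<otimes> Cod C g"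
  using is_pairing_pairing [OF assms] assms by (simp_all add: is_pairing_def hom_iff)

lemma pairing_proj [simp]:
  assumes "f \<in> Arr C" "g \<in> Arr C" "Dom C f = Dom C g" "Cod C f = X" "Cod C g = Y"
  shows "\<langle>f, g\<rangle> \<cdot> \<pi>0 X Y = \<rho> g \<cdot> f" "\<langle>f, g\<rangle> \<cdot> \<pi>1 X Y = \<rho> f \<cdot> g"
  using is_pairing_pairing [OF assms(1-3)] assms by (auto simp: is_pairing_def)

lemma pairing_proj_comp [simp]:
  assumes "f \<in> Arr C" "g \<in> Arr C" "Dom C f = Dom C g" "Cod C f = X" "Cod C g = Y" "h \<in> Arr C"
  shows "Dom C h = X \<Longrightarrow> \<langle>f, g\<rangle> \<cdot> (\<pi>0 X Y \<cdot> h) = \<rho> g \<cdot> (f \<cdot> h)"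
    and "Dom C h = Y \<Longrightarrow> \<langle>f, g\<rangle> \<cdot> (\<pi>1 X Y \<cdot> h) = \<rho> f \<cdot> (g \<cdot> h)"
  using assms pairing_proj [OF assms(1-5)]
    comp_assoc' [of "\<langle>f, g\<rangle>" "\<pi>0 X Y" h] comp_assoc' [of "\<langle>f, g\<rangle>" "\<pi>1 X Y" h]
    comp_assoc' [of "\<rho> g" f h] comp_assoc' [of "\<rho> f" g h]
  by (auto simp del: comp_assoc' pairing_proj)

lemma eq_pairingI:
  assumes "f \<in> Arr C" "g \<in> Arr C" "Dom C f = Dom C g"
    and "h \<in> Arr C" "Dom C h = Dom C g" "Cod C h = Cod C f \<otimes> Cod C g"
    and "h \<cdot> \<pi>0 (Cod C f) (Cod C g) = \<rho> g \<cdot> f" "h \<cdot> \<pi>1 (Cod C f) (Cod C g) = \<rho> f \<cdot> g"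
  shows "h = \<langle>f, g\<rangle>"
  using pairing_eqI [of f g h] assms by (simp add: is_pairing_def hom_iff)

section \<open>Pairings under composition and restriction\<close>

lemma comp_pairing [simp]:
  assumes "f \<in> Arr C" "g \<in> Arr C" "Dom C f = Dom C g" "h \<in> Arr C" "Cod C h = Dom C f"
  shows "h \<cdot> \<langle>f, g\<rangle> = \<langle>h \<cdot> f, h \<cdot> g\<rangle>"
proof (rule eq_pairingI)
  \<comment> \<open>The projections of \<open>h \<cdot> \<langle>f, g\<rangle>\<close> carry a
    restriction to the right of \<open>h\<close>; [R.4] moves it to the left, where it is the
    restriction required of a pairing of the two composites.\<close>
  have "h \<cdot> (\<rho> g \<cdot> f) = (h \<cdot> \<rho> g) \<cdot> f" "h \<cdot> (\<rho> f \<cdot> g) = (h \<cdot> \<rho> f) \<cdot> g"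
    using assms by simp_all
  then have "h \<cdot> (\<rho> g \<cdot> f) = \<rho> (h \<cdot> g) \<cdot> (h \<cdot> f)" "h \<cdot> (\<rho> f \<cdot> g) = \<rho> (h \<cdot> f) \<cdot> (h \<cdot> g)"
    using assms comp_rst [of h f] comp_rst [of h g] by simp_all
  then show "(h \<cdot> \<langle>f, g\<rangle>) \<cdot> \<pi>0 (Cod C (h \<cdot> f)) (Cod C (h \<cdot> g)) = \<rho> (h \<cdot> g) \<cdot> (h \<cdot> f)"
    and "(h \<cdot> \<langle>f, g\<rangle>) \<cdot> \<pi>1 (Cod C (h \<cdot> f)) (Cod C (h \<cdot> g)) = \<rho> (h \<cdot> f) \<cdot> (h \<cdot> g)"
    using assms by simp_all
qed (use assms in simp_all)

text \<open>Composing with the total map \<open>\<pi>0\<close> preserves the restriction, and the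
  first projection of the pairing is \<open>\<rho> g \<cdot> f\<close>.\<close>

lemma rst_pairing [simp]:
  assumes "f \<in> Arr C" "g \<in> Arr C" "Dom C f = Dom C g"
  shows "\<rho> \<langle>f, g\<rangle> = \<rho> f \<cdot> \<rho> g"
proof -
  have "\<rho> \<langle>f, g\<rangle> = \<rho> (\<langle>f, g\<rangle> \<cdot> \<pi>0 (Cod C f) (Cod C g))"
    using assms by (subst rst_comp_total) simp_all
  also have "\<dots> = \<rho> f \<cdot> \<rho> g"
    using assms by (simp add: rst_commute del: rst_comp_total)
  finally show ?thesis .
qed

text \<open>Each component of a pairing is already restricted to the domain of the other, so a
  restriction on one component cuts down the whole pairing. With \<open>pairing_rst_right\<close>,
  restrictions can be moved freely between the components.\<close>

lemma pairing_rst_left: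
  assumes "f \<in> Arr C" "g \<in> Arr C" "h \<in> Arr C" "Dom C f = Dom C h" "Dom C g = Dom C h"
  shows "\<langle>\<rho> h \<cdot> f, g\<rangle> = \<rho> h \<cdot> \<langle>f, g\<rangle>"
proof (rule eq_pairingI [symmetric])
  show "(\<rho> h \<cdot> \<langle>f, g\<rangle>) \<cdot> \<pi>0 (Cod C (\<rho> h \<cdot> f)) (Cod C g) = \<rho> g \<cdot> (\<rho> h \<cdot> f)"
    using assms by (simp del: comp_pairing add: rst_left_commute)
qed (use assms in \<open>simp_all del: comp_pairing\<close>)

lemma pairing_rst_right:
  assumes "f \<in> Arr C" "g \<in> Arr C" "h \<in> Arr C" "Dom C f = Dom C h" "Dom C g = Dom C h"
  shows "\<langle>f, \<rho> h \<cdot> g\<rangle> = \<rho> h \<cdot> \<langle>f, g\<rangle>"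
proof (rule eq_pairingI [symmetric])
  show "(\<rho> h \<cdot> \<langle>f, g\<rangle>) \<cdot> \<pi>1 (Cod C f) (Cod C (\<rho> h \<cdot> g)) = \<rho> f \<cdot> (\<rho> h \<cdot> g)"
    using assms by (simp del: comp_pairing add: rst_left_commute)
qed (use assms in \<open>simp_all del: comp_pairing\<close>)

lemma pairing_proj_idt [simp]:
  assumes "X \<in> Obj C" "Y \<in> Obj C"
  shows "\<langle>\<pi>0 X Y, \<pi>1 X Y\<rangle> = \<iota> (X \<otimes> Y)"
  by (rule eq_pairingI [symmetric]) (use assms in simp_all)

section \<open>Products of maps\<close>

lemma prod_map_arr [simp]:
  assumes "f \<in> Arr C" "g \<in> Arr C"
  shows "f \<odot> g \<in> Arr C" "Dom C (f \<odot> g) = Dom C f \<otimes> Dom C g"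
    "Cod C (f \<odot> g) = Cod C f \<otimes> Cod C g"
  using assms by (simp_all add: prod_map_def)

lemma prod_map_idt [simp]: "\<lbrakk>X \<in> Obj C; Y \<in> Obj C\<rbrakk> \<Longrightarrow> \<iota> X \<odot> \<iota> Y = \<iota> (X \<otimes> Y)"
  by (simp add: prod_map_def)

lemma pairing_prod_map [simp]:
  assumes "f \<in> Arr C" "g \<in> Arr C" "h \<in> Arr C" "k \<in> Arr C"
    and "Dom C f = Dom C g" "Cod C f = Dom C h" "Cod C g = Dom C k"
  shows "\<langle>f, g\<rangle> \<cdot> (h \<odot> k) = \<langle>f \<cdot> h, g \<cdot> k\<rangle>"
proof -
  have "\<langle>f, g\<rangle> \<cdot> (h \<odot> k) = \<langle>\<rho> g \<cdot> (f \<cdot> h), \<rho> f \<cdot> (g \<cdot> k)\<rangle>"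
    using assms by (simp add: prod_map_def)
  \<comment> \<open>Both restrictions leave the pairing and re-enter in the other component, where
    [R.1] absorbs them.\<close>
  also have "\<dots> = \<langle>\<rho> f \<cdot> (f \<cdot> h), \<rho> g \<cdot> (g \<cdot> k)\<rangle>"
    using assms by (simp add: pairing_rst_left pairing_rst_right rst_left_commute
        del: comp_pairing)
  also have "\<dots> = \<langle>f \<cdot> h, g \<cdot> k\<rangle>"
    using assms comp_assoc' [of "\<rho> f" f h] comp_assoc' [of "\<rho> g" g k]
    by (simp del: comp_assoc')
  finally show ?thesis .
qed

lemma prod_map_comp:
  assumes "f \<in> Arr C" "g \<in> Arr C" "h \<in> Arr C" "k \<in> Arr C"
    and "Cod C f = Dom C h" "Cod C g = Dom C k"
  shows "(f \<odot> g) \<cdot> (h \<odot> k) = (f \<cdot> h) \<odot> (g \<cdot> k)"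
  unfolding prod_map_def [of C f g] using assms
  by (simp add: prod_map_def [of C "f \<cdot> h"])

text \<open>By [R.4] each projection followed by a restriction is a restriction of that projection.
  Pulled out of the pairing, the two restrictions leave only the pairing of the projections, which
  is an identity.\<close>

lemma prod_map_rst [simp]:
  assumes "f \<in> Arr C" "g \<in> Arr C"
  shows "\<rho> f \<odot> \<rho> g = \<rho> (\<pi>0 (Dom C f) (Dom C g) \<cdot> f) \<cdot> \<rho> (\<pi>1 (Dom C f) (Dom C g) \<cdot> g)"
  using assms
  by (simp add: prod_map_def comp_rst [of "\<pi>0 (Dom C f) (Dom C g)" f]
      comp_rst [of "\<pi>1 (Dom C f) (Dom C g)" g] pairing_rst_left pairing_rst_right
      rst_commute [of "\<pi>1 (Dom C f) (Dom C g) \<cdot> g"] del: comp_pairing)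

lemma restriction_idempotent_prod_map:
  assumes "restriction_idempotent C X e" "restriction_idempotent C Y e'"
  shows "restriction_idempotent C (X \<otimes> Y) (e \<odot> e')"
    and "e \<odot> e' = \<rho> (\<pi>0 X Y \<cdot> e) \<cdot> \<rho> (\<pi>1 X Y \<cdot> e')"
proof -
  show eq: "e \<odot> e' = \<rho> (\<pi>0 X Y \<cdot> e) \<cdot> \<rho> (\<pi>1 X Y \<cdot> e')"
    using assms prod_map_rst [of e e'] by (auto simp: restriction_idempotent_iff)
  show "restriction_idempotent C (X \<otimes> Y) (e \<odot> e')"
    using assms unfolding restriction_idempotent_iff
    by (auto simp: eq)
qed

end

section \<open>The restriction idempotent splitting\<close>

lemma Kr_simps [simp]:
  "Dom (Kr C) (A, f, B) = A"
  "Cod (Kr C) (A, f, B) = B"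
  "idt (Kr C) (X, e) = ((X, e), e, (X, e))"
  "comp (Kr C) (A, f, B) (B', g, E) = (A, f \<cdot>\<^bsub>C\<^esub> g, E)"
  "rst (Kr C) (A, f, B) = (A, \<rho>\<^bsub>C\<^esub> f, A)"
  "unit_obj (Kr C) = (\<one>\<^bsub>C\<^esub>, \<iota>\<^bsub>C\<^esub> \<one>\<^bsub>C\<^esub>)"
  "prod_obj (Kr C) (X, e) (Y, e') = (X \<otimes>\<^bsub>C\<^esub> Y, e \<odot>\<^bsub>C\<^esub> e')"
  "proj0 (Kr C) (X, e) (Y, e') =
    ((X \<otimes>\<^bsub>C\<^esub> Y, e \<odot>\<^bsub>C\<^esub> e'), (e \<odot>\<^bsub>C\<^esub> e') \<cdot>\<^bsub>C\<^esub> \<pi>0\<^bsub>C\<^esub> X Y, (X, e))"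
  "proj1 (Kr C) (X, e) (Y, e') =
    ((X \<otimes>\<^bsub>C\<^esub> Y, e \<odot>\<^bsub>C\<^esub> e'), (e \<odot>\<^bsub>C\<^esub> e') \<cdot>\<^bsub>C\<^esub> \<pi>1\<^bsub>C\<^esub> X Y, (Y, e'))"
  "Lobj (Kr C) (X, e) = (L0\<^bsub>C\<^esub> X, \<iota>\<^bsub>C\<^esub> (L0\<^bsub>C\<^esub> X))"
  "Ladd (Kr C) (X, e) =
    ((L0\<^bsub>C\<^esub> X \<otimes>\<^bsub>C\<^esub> L0\<^bsub>C\<^esub> X, \<iota>\<^bsub>C\<^esub> (L0\<^bsub>C\<^esub> X) \<odot>\<^bsub>C\<^esub> \<iota>\<^bsub>C\<^esub> (L0\<^bsub>C\<^esub> X)),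
      \<alpha>\<^bsub>C\<^esub> X, (L0\<^bsub>C\<^esub> X, \<iota>\<^bsub>C\<^esub> (L0\<^bsub>C\<^esub> X)))"
  "Lzero (Kr C) (X, e) = ((\<one>\<^bsub>C\<^esub>, \<iota>\<^bsub>C\<^esub> \<one>\<^bsub>C\<^esub>), \<zeta>\<^bsub>C\<^esub> X, (L0\<^bsub>C\<^esub> X, \<iota>\<^bsub>C\<^esub> (L0\<^bsub>C\<^esub> X)))"
  "diff (Kr C) ((X, e), f, (Y, e')) =
    ((L0\<^bsub>C\<^esub> X \<otimes>\<^bsub>C\<^esub> X, \<iota>\<^bsub>C\<^esub> (L0\<^bsub>C\<^esub> X) \<odot>\<^bsub>C\<^esub> e), \<partial>\<^bsub>C\<^esub> f, (L0\<^bsub>C\<^esub> Y, \<iota>\<^bsub>C\<^esub> (L0\<^bsub>C\<^esub> Y)))"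
  by (simp_all add: Kr_def)

text \<open>The identity of \<open>(X, e)\<close> is \<open>e\<close>, so a map that is total in the
  splitting may well be partial in \<open>C\<close>.\<close>

lemma total_Kr_iff [simp]: "total (Kr C) ((X, e), f, B) \<longleftrightarrow> rst C f = e"
  by (auto simp: total_def)

text \<open>The record type has the differential fields because \<open>Kr\<close> takes such a
  record; the laws assumed here are the Cartesian ones.\<close>

locale restriction_idempotent_splitting = cartesian_restriction_category C
  for C :: "('o, 'a) gen_diff_restr_cat" (structure)
begin

section \<open>Objects, arrows and restriction category laws of the splitting\<close>

lemma Kr_Obj_iff [simp]: "(X, e) \<in> Obj (Kr C) \<longleftrightarrow> restriction_idempotent C X e"
  by (auto simp: Kr_def restriction_idempotent_iff)

text \<open>Composites are normalised to nest to the right, which hides the redex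
  \<open>e \<cdot> f\<close>; this and \<open>fixed_comp_right\<close> perform the absorption in
  that form.\<close>

lemma fixed_comp_left:
  "\<lbrakk>e \<in> Arr C; f \<in> Arr C; g \<in> Arr C; Cod C e = Dom C f; Cod C f = Dom C g; e \<cdot> f = f\<rbrakk>
    \<Longrightarrow> e \<cdot> (f \<cdot> g) = f \<cdot> g"
  using comp_assoc' [of e f g] by (simp del: comp_assoc')

lemma fixed_comp_right:
  "\<lbrakk>f \<in> Arr C; e \<in> Arr C; g \<in> Arr C; Cod C f = Dom C e; Cod C e = Dom C g; f \<cdot> e = f\<rbrakk>
    \<Longrightarrow> f \<cdot> (e \<cdot> g) = f \<cdot> g"
  using comp_assoc' [of f e g] by (simp del: comp_assoc')

text \<open>Since \<open>e = \<rho> e\<close>, [R.3] turns \<open>\<rho> (e \<cdot> f)\<close> into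
  \<open>e \<cdot> \<rho> f\<close>; the other equation follows by [R.2]. So the restriction of a
  map of the splitting is an endomap of its domain there.\<close>

lemma fixed_rst:
  assumes "restriction_idempotent C X e" "f \<in> Arr C" "Dom C f = X" "e \<cdot> f = f"
  shows "e \<cdot> \<rho> f = \<rho> f" "\<rho> f \<cdot> e = \<rho> f"
proof -
  show *: "e \<cdot> \<rho> f = \<rho> f"
    using assms rst_rst_comp [of e f] by (auto simp: restriction_idempotent_iff)
  show "\<rho> f \<cdot> e = \<rho> f"
    using assms * rst_commute [of e f] by (auto simp: restriction_idempotent_iff)
qed

text \<open>The two-sided condition \<open>e \<cdot> f \<cdot> e' = f\<close> splits in two because
  \<open>e\<close> and \<open>e'\<close> are idempotent; the one-sided equations are the ones that
  rewrite.\<close>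

lemma Kr_Arr_iff [simp]:
  "((X, e), f, (Y, e')) \<in> Arr (Kr C) \<longleftrightarrow>
    restriction_idempotent C X e \<and> restriction_idempotent C Y e' \<and>
    f \<in> Arr C \<and> Dom C f = X \<and> Cod C f = Y \<and> e \<cdot> f = f \<and> f \<cdot> e' = f"
    (is "?lhs \<longleftrightarrow> ?rhs")
proof
  assume ?lhs
  then have idem: "restriction_idempotent C X e" "restriction_idempotent C Y e'"
    and f: "f \<in> Arr C" "Dom C f = X" "Cod C f = Y" "e \<cdot> f \<cdot> e' = f"
    by (auto simp: Kr_def hom_iff)
  have e: "e \<in> Arr C" "Dom C e = X" "Cod C e = X" "e' \<in> Arr C" "Dom C e' = Y" "Cod C e' = Y"
    using idem by (auto simp: restriction_idempotent_iff)
  have "e \<cdot> f = e \<cdot> (e \<cdot> (f \<cdot> e'))"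
    using f e by simp
  also have "\<dots> = (e \<cdot> e) \<cdot> (f \<cdot> e')"
    using f e by (subst comp_assoc') auto
  also have "\<dots> = f"
    using f e idem by (simp add: restriction_idempotent_comp_self)
  finally have ef: "e \<cdot> f = f" .
  then have "f \<cdot> e' = f"
    using f(4) by simp
  then show ?rhs
    using idem f ef by simp
next
  assume ?rhs
  then show ?lhs
    by (auto simp: Kr_def hom_iff restriction_idempotent_iff)
qed

lemma Kr_hom_iff:
  "\<phi> \<in> hom (Kr C) (X, e) (Y, e') \<longleftrightarrow>
    (\<exists>f. \<phi> = ((X, e), f, (Y, e')) \<and>
      restriction_idempotent C X e \<and> restriction_idempotent C Y e' \<and>
      f \<in> Arr C \<and> Dom C f = X \<and> Cod C f = Y \<and> e \<cdot> f = f \<and> f \<cdot> e' = f)"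
  by (cases \<phi>) (auto simp: hom_def)

lemma restriction_category_Kr: "restriction_category (Kr C)"
proof (unfold_locales, goal_cases)
  case (1 f)
  then show ?case by (cases f) auto
next
  case (2 f)
  then show ?case by (cases f) auto
next
  case (3 X)
  then show ?case
    by (cases X) (auto simp: Kr_hom_iff restriction_idempotent_comp_self,
        auto simp: restriction_idempotent_iff)
next
  case (4 f X Y g Z)
  then show ?case
    by (cases X; cases Y; cases Z)
      (auto simp: Kr_hom_iff restriction_idempotent_iff fixed_comp_left)
next
  case (5 f X Y)
  then show ?case by (cases X; cases Y) (auto simp: Kr_hom_iff)
next
  case (6 f X Y)
  then show ?case by (cases X; cases Y) (auto simp: Kr_hom_iff)
next
  case (7 f W X g Y h Z)
  then show ?case by (cases W; cases X; cases Y; cases Z) (auto simp: Kr_hom_iff)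
next
  case (8 f X Y)
  then show ?case by (cases X; cases Y) (auto simp: Kr_hom_iff fixed_rst)
next
  case (9 f X Y)
  then show ?case by (cases X; cases Y) (auto simp: Kr_hom_iff)
next
  case (10 f X Y g Z)
  then show ?case by (cases X; cases Y; cases Z) (auto simp: Kr_hom_iff rst_commute)
next
  case (11 f X Y g Z)
  then show ?case by (cases X; cases Y; cases Z) (auto simp: Kr_hom_iff)
next
  case (12 f X Y g Z)
  then show ?case by (cases X; cases Y; cases Z) (auto simp: Kr_hom_iff intro: comp_rst)
qed

section \<open>Terminal object and restriction products of the splitting\<close>

lemma bang_Kr_iff:
  assumes "restriction_idempotent C X e"
  shows "t \<in> hom (Kr C) (X, e) (unit_obj (Kr C)) \<and> total (Kr C) t \<longleftrightarrow>
    t = ((X, e), e \<cdot> \<tau> X, (\<one>, \<iota> \<one>))"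
proof
  \<comment> \<open>In \<open>C\<close> a map \<open>t\<close> into the unit is
    \<open>\<rho> t\<close> followed by the terminal map, and totality in the splitting says
    \<open>\<rho> t = e\<close>.\<close>
  assume "t \<in> hom (Kr C) (X, e) (unit_obj (Kr C)) \<and> total (Kr C) t"
  then show "t = ((X, e), e \<cdot> \<tau> X, (\<one>, \<iota> \<one>))"
    using to_unit_eq by (auto simp: Kr_hom_iff)
next
  have e: "e \<in> Arr C" "Dom C e = X" "Cod C e = X" "\<rho> e = e" "X \<in> Obj C" "e \<cdot> e = e"
    using assms by (auto simp: restriction_idempotent_iff restriction_idempotent_comp_self)
  assume t: "t = ((X, e), e \<cdot> \<tau> X, (\<one>, \<iota> \<one>))"
  show "t \<in> hom (Kr C) (X, e) (unit_obj (Kr C)) \<and> total (Kr C) t"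
    using e by (simp add: t Kr_hom_iff fixed_comp_left restriction_idempotent_iff)
qed

lemma bang_Kr [simp]:
  assumes "restriction_idempotent C X e"
  shows "bang (Kr C) (X, e) = ((X, e), e \<cdot> \<tau> X, (\<one>, \<iota> \<one>))"
  unfolding bang_def [of "Kr C"] by (simp only: bang_Kr_iff [OF assms] the_eq_trivial)

text \<open>A map \<open>k\<close> into \<open>(X \<otimes> Y, e\<^sub>1 \<odot> e\<^sub>2)\<close>
  absorbs that idempotent, so its composites with the projections of the splitting are those with
  the projections of \<open>C\<close>, and uniqueness is inherited. The equivalence yields both
  unique existence and the value of the pairing.\<close>

lemma is_pairing_Kr_iff:
  assumes "((W, e), f, (X, e\<^sub>1)) \<in> Arr (Kr C)" "((W, e), g, (Y, e\<^sub>2)) \<in> Arr (Kr C)"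
  shows "is_pairing (Kr C) ((W, e), f, (X, e\<^sub>1)) ((W, e), g, (Y, e\<^sub>2)) h \<longleftrightarrow>
    h = ((W, e), \<langle>f, g\<rangle>, (X \<otimes> Y, e\<^sub>1 \<odot> e\<^sub>2))"
proof -
  have f: "f \<in> Arr C" "Dom C f = W" "Cod C f = X" "e \<cdot> f = f" "f \<cdot> e\<^sub>1 = f"
    and g: "g \<in> Arr C" "Dom C g = W" "Cod C g = Y" "e \<cdot> g = g" "g \<cdot> e\<^sub>2 = g"
    and idem: "restriction_idempotent C W e" "restriction_idempotent C X e\<^sub>1"
      "restriction_idempotent C Y e\<^sub>2"
    and e: "e \<in> Arr C" "Dom C e = W" "Cod C e = W"
      "e\<^sub>1 \<in> Arr C" "Dom C e\<^sub>1 = X" "Cod C e\<^sub>1 = X"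
      "e\<^sub>2 \<in> Arr C" "Dom C e\<^sub>2 = Y" "Cod C e\<^sub>2 = Y"
    using assms by (auto simp: restriction_idempotent_iff)
  have objs: "X \<in> Obj C" "Y \<in> Obj C"
    using f g by auto
  have proj: "k \<cdot> ((e\<^sub>1 \<odot> e\<^sub>2) \<cdot> \<pi>0 X Y) = k \<cdot> \<pi>0 X Y"
    "k \<cdot> ((e\<^sub>1 \<odot> e\<^sub>2) \<cdot> \<pi>1 X Y) = k \<cdot> \<pi>1 X Y"
    if "k \<in> Arr C" "Cod C k = X \<otimes> Y" "k \<cdot> (e\<^sub>1 \<odot> e\<^sub>2) = k" for k
    using that e objs by (simp_all add: fixed_comp_right)
  show ?thesis
  proof
    assume "is_pairing (Kr C) ((W, e), f, (X, e\<^sub>1)) ((W, e), g, (Y, e\<^sub>2)) h"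
    then obtain k where h: "h = ((W, e), k, (X \<otimes> Y, e\<^sub>1 \<odot> e\<^sub>2))"
      and k: "k \<in> Arr C" "Dom C k = W" "Cod C k = X \<otimes> Y" "k \<cdot> (e\<^sub>1 \<odot> e\<^sub>2) = k"
      and "k \<cdot> ((e\<^sub>1 \<odot> e\<^sub>2) \<cdot> \<pi>0 X Y) = \<rho> g \<cdot> f" "k \<cdot> ((e\<^sub>1 \<odot> e\<^sub>2) \<cdot> \<pi>1 X Y) = \<rho> f \<cdot> g"
      by (auto simp: is_pairing_def Kr_hom_iff)
    then have "k \<cdot> \<pi>0 X Y = \<rho> g \<cdot> f" "k \<cdot> \<pi>1 X Y = \<rho> f \<cdot> g"
      by (simp_all add: proj)
    then have "k = \<langle>f, g\<rangle>"
      using f g k by (intro eq_pairingI) simp_all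
    then show "h = ((W, e), \<langle>f, g\<rangle>, (X \<otimes> Y, e\<^sub>1 \<odot> e\<^sub>2))"
      by (simp add: h)
  next
    assume h: "h = ((W, e), \<langle>f, g\<rangle>, (X \<otimes> Y, e\<^sub>1 \<odot> e\<^sub>2))"
    have "\<langle>f, g\<rangle> \<cdot> (e\<^sub>1 \<odot> e\<^sub>2) = \<langle>f, g\<rangle>"
      using f g e by simp
    then show "is_pairing (Kr C) ((W, e), f, (X, e\<^sub>1)) ((W, e), g, (Y, e\<^sub>2)) h"
      using f g e idem
      by (simp add: h is_pairing_def Kr_hom_iff restriction_idempotent_prod_map(1) proj
          del: pairing_prod_map)
  qed
qed

lemma pairing_Kr [simp]:
  assumes "((W, e), f, (X, e\<^sub>1)) \<in> Arr (Kr C)" "((W, e), g, (Y, e\<^sub>2)) \<in> Arr (Kr C)"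
  shows "pairing (Kr C) ((W, e), f, (X, e\<^sub>1)) ((W, e), g, (Y, e\<^sub>2)) =
    ((W, e), \<langle>f, g\<rangle>, (X \<otimes> Y, e\<^sub>1 \<odot> e\<^sub>2))"
  unfolding pairing_def [of "Kr C"] by (rule the_equality; simp only: is_pairing_Kr_iff [OF assms])

text \<open>In \<open>(e \<odot> e') \<cdot> \<pi>0 X Y\<close> the last factor can be taken to be
  \<open>e\<close>, so composing with \<open>e\<close> changes nothing; similarly for
  \<open>\<pi>1\<close>. As the projections are total in \<open>C\<close>, the restriction is
  \<open>e \<odot> e'\<close>, the identity of the product object.\<close>

lemma proj_Kr_Arr:
  assumes "restriction_idempotent C X e" "restriction_idempotent C Y e'"
  shows "proj0 (Kr C) (X, e) (Y, e') \<in> Arr (Kr C)" (is ?P1)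
    and "proj1 (Kr C) (X, e) (Y, e') \<in> Arr (Kr C)" (is ?P2)
    and "total (Kr C) (proj0 (Kr C) (X, e) (Y, e'))" (is ?P3)
    and "total (Kr C) (proj1 (Kr C) (X, e) (Y, e'))" (is ?P4)
proof -
  note idem = restriction_idempotent_prod_map [OF assms]
  have e: "e \<in> Arr C" "Dom C e = X" "Cod C e = X" "e' \<in> Arr C" "Dom C e' = Y" "Cod C e' = Y"
    "X \<in> Obj C" "Y \<in> Obj C" "\<rho> e = e" "\<rho> e' = e'"
    using assms by (auto simp: restriction_idempotent_iff)
  have ee: "(e \<odot> e') \<cdot> (e \<odot> e') = e \<odot> e'"
    using idem(1) by (rule restriction_idempotent_comp_self)
  have proj: "(e \<odot> e') \<cdot> \<pi>0 X Y = \<rho> (\<pi>1 X Y \<cdot> e') \<cdot> (\<pi>0 X Y \<cdot> e)"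
    "(e \<odot> e') \<cdot> \<pi>1 X Y = \<rho> (\<pi>0 X Y \<cdot> e) \<cdot> (\<pi>1 X Y \<cdot> e')"
    using e by (simp_all add: prod_map_def)
  have "(e \<odot> e') \<cdot> \<pi>0 X Y \<cdot> e = (e \<odot> e') \<cdot> \<pi>0 X Y"
    "(e \<odot> e') \<cdot> \<pi>1 X Y \<cdot> e' = (e \<odot> e') \<cdot> \<pi>1 X Y"
    using e assms unfolding proj by (simp_all add: restriction_idempotent_comp_self)
  moreover have "\<rho> ((e \<odot> e') \<cdot> \<pi>0 X Y) = e \<odot> e'" "\<rho> ((e \<odot> e') \<cdot> \<pi>1 X Y) = e \<odot> e'"
    using e idem(1) by (simp_all add: restriction_idempotent_iff)
  ultimately show ?P1 ?P2 ?P3 ?P4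
    using e assms idem(1) by (simp_all add: fixed_comp_left ee)
qed

lemma cartesian_restriction_category_Kr: "cartesian_restriction_category (Kr C)"
proof (intro cartesian_restriction_category.intro restriction_category_Kr
    cartesian_restriction_category_axioms.intro, goal_cases)
  case 1
  then show ?case by (simp add: restriction_idempotent_iff)
next
  case (2 X)
  then show ?case by (cases X) (simp only: Kr_Obj_iff bang_Kr_iff, simp)
next
  case (3 f X)
  then obtain W e g where X: "X = (W, e)" and f: "f = ((W, e), g, (\<one>, \<iota> \<one>))"
    and g: "restriction_idempotent C W e" "g \<in> Arr C" "Dom C g = W" "Cod C g = \<one>" "e \<cdot> g = g"
    by (cases X) (auto simp: Kr_hom_iff)
  \<comment> \<open>\<open>\<rho> g\<close> absorbs \<open>e\<close> because
    \<open>e \<cdot> g = g\<close>; what remains is the terminal law in \<open>C\<close>.\<close>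
  have "\<rho> g \<cdot> (e \<cdot> \<tau> W) = g"
    using g fixed_rst [of W e g] to_unit_eq [of g]
    by (auto simp: restriction_idempotent_iff fixed_comp_right)
  then show ?case using g by (simp add: X f)
next
  case (4 X Y)
  then show ?case by (cases X; cases Y) (simp add: restriction_idempotent_prod_map(1))
next
  case (5 X Y)
  then show ?case using proj_Kr_Arr(1) by (cases X; cases Y) (simp add: hom_def)
next
  case (6 X Y)
  then show ?case using proj_Kr_Arr(2) by (cases X; cases Y) (simp add: hom_def)
next
  case (7 X Y)
  then show ?case using proj_Kr_Arr(3) by (cases X; cases Y) (simp only: Kr_Obj_iff)
next
  case (8 X Y)
  then show ?case using proj_Kr_Arr(4) by (cases X; cases Y) (simp only: Kr_Obj_iff)
next
  case (9 f Z X g Y)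
  obtain W e X' e\<^sub>1 Y' e\<^sub>2 where "Z = (W, e)" "X = (X', e\<^sub>1)" "Y = (Y', e\<^sub>2)"
    by (cases Z; cases X; cases Y)
  then obtain f' g' where "f = ((W, e), f', (X', e\<^sub>1))" "g = ((W, e), g', (Y', e\<^sub>2))"
    and arr: "((W, e), f', (X', e\<^sub>1)) \<in> Arr (Kr C)" "((W, e), g', (Y', e\<^sub>2)) \<in> Arr (Kr C)"
    using 9 by (auto simp: Kr_hom_iff)
  then show ?case by (simp only: is_pairing_Kr_iff [OF arr], simp)
qed

section \<open>Product maps and monoids in the splitting\<close>

lemma prod_map_Kr [simp]:
  assumes "((X, e), f, (X', e')) \<in> Arr (Kr C)" "((Y, d), g, (Y', d')) \<in> Arr (Kr C)"
  shows "prod_map (Kr C) ((X, e), f, (X', e')) ((Y, d), g, (Y', d')) =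
    ((X \<otimes> Y, e \<odot> d), f \<odot> g, (X' \<otimes> Y', e' \<odot> d'))"
proof -
  interpret K: cartesian_restriction_category "Kr C"
    by (rule cartesian_restriction_category_Kr)
  have objs: "restriction_idempotent C X e" "restriction_idempotent C Y d"
    and f: "f \<in> Arr C" "Dom C f = X" "Cod C f = X'" "e \<cdot> f = f"
    and g: "g \<in> Arr C" "Dom C g = Y" "Cod C g = Y'" "d \<cdot> g = g"
    and e: "e \<in> Arr C" "Dom C e = X" "Cod C e = X" "d \<in> Arr C" "Dom C d = Y" "Cod C d = Y"
    using assms by (auto simp: restriction_idempotent_iff)
  have XY: "X \<in> Obj C" "Y \<in> Obj C"
    using f g by auto
  have arr: "((X \<otimes> Y, e \<odot> d), (e \<odot> d) \<cdot> \<pi>0 X Y \<cdot> f, (X', e')) \<in> Arr (Kr C)"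
    "((X \<otimes> Y, e \<odot> d), (e \<odot> d) \<cdot> \<pi>1 X Y \<cdot> g, (Y', d')) \<in> Arr (Kr C)"
    using K.comp_arr(1) [of "proj0 (Kr C) (X, e) (Y, d)" "((X, e), f, (X', e'))"]
      K.comp_arr(1) [of "proj1 (Kr C) (X, e) (Y, d)" "((Y, d), g, (Y', d'))"]
      proj_Kr_Arr(1,2) [OF objs] assms
    by (simp_all del: Kr_Arr_iff)
  \<comment> \<open>The idempotent carried by the projections of the splitting comes out of the
    pairing; it is then absorbed since \<open>e \<cdot> f = f\<close> and
    \<open>d \<cdot> g = g\<close>.\<close>
  have "\<langle>(e \<odot> d) \<cdot> \<pi>0 X Y \<cdot> f, (e \<odot> d) \<cdot> \<pi>1 X Y \<cdot> g\<rangle> = (e \<odot> d) \<cdot> (f \<odot> g)"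
    using f g e XY unfolding prod_map_def [of C f g] by simp
  also have "\<dots> = f \<odot> g"
    using f g e by (simp add: prod_map_comp)
  finally show ?thesis
    unfolding prod_map_def [of "Kr C"] by (simp only: Kr_simps pairing_Kr [OF arr])
qed

lemma restriction_idempotent_idt [simp]: "X \<in> Obj C \<Longrightarrow> restriction_idempotent C X (\<iota> X)"
  by (simp add: restriction_idempotent_iff)

text \<open>The carrier has an identity as its idempotent, hence so do its powers. Pairings,
  products and terminal maps between these objects have the same underlying maps as in
  \<open>C\<close>, so every monoid law is the one in \<open>C\<close>.\<close>

lemma total_commutative_monoid_Kr:
  assumes "total_commutative_monoid C A add zero"
  shows "total_commutative_monoid (Kr C) (A, \<iota> A)
    ((A \<otimes> A, \<iota> (A \<otimes> A)), add, (A, \<iota> A)) ((\<one>, \<iota> \<one>), zero, (A, \<iota> A))"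
proof -
  interpret M: total_commutative_monoid C A add zero
    by (rule assms)
  have arr: "A \<in> Obj C" "add \<in> Arr C" "Dom C add = A \<otimes> A" "Cod C add = A"
    "zero \<in> Arr C" "Dom C zero = \<one>" "Cod C zero = A"
    "\<rho> add = \<iota> (A \<otimes> A)" "\<rho> zero = \<iota> \<one>"
    using M.carrier_Obj M.add_hom M.zero_hom M.add_total M.zero_total
    by (auto simp: hom_iff total_def)
  show ?thesis
  proof (intro total_commutative_monoid.intro cartesian_restriction_category_Kr
      total_commutative_monoid_axioms.intro, goal_cases)
    case 6
    then show ?case using arr M.add_assoc by simp
  qed (use arr M.zero_left M.zero_right M.add_commute in \<open>simp_all add: Kr_hom_iff\<close>)
qed

section \<open>Absorption of idempotents\<close>

lemma idt_prod_map:
  assumes "A \<in> Obj C" "restriction_idempotent C X e"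
  shows "\<iota> A \<odot> e = \<rho> (\<pi>1 A X \<cdot> e)"
proof -
  have e: "e \<in> Arr C" "Dom C e = X" "Cod C e = X" "\<rho> e = e" "X \<in> Obj C"
    using assms by (auto simp: restriction_idempotent_iff)
  then show ?thesis
    using assms restriction_idempotent_prod_map(2) [of A "\<iota> A" X e] by simp
qed

text \<open>This is [R.4] for \<open>\<pi>1 A X\<close> and \<open>e = \<rho> e\<close>.\<close>

lemma idt_prod_map_proj1:
  assumes "A \<in> Obj C" "restriction_idempotent C X e"
  shows "(\<iota> A \<odot> e) \<cdot> \<pi>1 A X = \<pi>1 A X \<cdot> e"
proof -
  have e: "e \<in> Arr C" "Dom C e = X" "Cod C e = X" "\<rho> e = e" "X \<in> Obj C"
    using assms by (auto simp: restriction_idempotent_iff)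
  then show ?thesis
    using assms(1) comp_rst [of "\<pi>1 A X" e] by (simp add: idt_prod_map [OF assms])
qed

lemma idt_prod_map_proj1_comp [simp]:
  assumes "A \<in> Obj C" "restriction_idempotent C X e" "f \<in> Arr C" "Dom C f = X"
  shows "(\<iota> A \<odot> e) \<cdot> (\<pi>1 A X \<cdot> f) = \<pi>1 A X \<cdot> (e \<cdot> f)"
proof -
  have e: "e \<in> Arr C" "Dom C e = X" "Cod C e = X" "X \<in> Obj C"
    using assms by (auto simp: restriction_idempotent_iff)
  then show ?thesis
    using assms(1,3,4) comp_assoc' [of "\<iota> A \<odot> e" "\<pi>1 A X" f]
    by (simp add: idt_prod_map_proj1 [OF assms(1,2)])
qed

text \<open>Meant for the zero map of the splitting, which is the zero map of \<open>C\<close>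
  preceded by the idempotent of its domain.\<close>

lemma idempotent_comp:
  assumes "restriction_idempotent C (Dom C g) e" "g \<in> Arr C"
  shows "e \<cdot> g \<in> Arr C" "Dom C (e \<cdot> g) = Dom C g" "Cod C (e \<cdot> g) = Cod C g"
    "e \<cdot> (e \<cdot> g) = e \<cdot> g"
  using assms rst_left_idem [of e g] by (auto simp: restriction_idempotent_iff)

text \<open>As \<open>e\<close> fixes \<open>f\<close>, it fixes \<open>f \<cdot> g\<close> and is
  absorbed by its restriction. This removes the idempotent from the zero on the right of the second
  law of DR.2.\<close>

lemma rst_fixed_comp:
  assumes "restriction_idempotent C (Dom C f) e" "e \<cdot> f = f"
    "f \<in> Arr C" "g \<in> Arr C" "h \<in> Arr C" "Cod C f = Dom C g" "Dom C f = Dom C h"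
  shows "\<rho> (f \<cdot> g) \<cdot> (e \<cdot> h) = \<rho> (f \<cdot> g) \<cdot> h"
  using assms fixed_rst(2) [of "Dom C f" e "f \<cdot> g"]
  by (simp add: restriction_idempotent_iff fixed_comp_left fixed_comp_right)

text \<open>Shows that the two summands in DR.2 are maps of the splitting, so that their pairing
  there can be computed in \<open>C\<close>.\<close>

lemma fixed_pairing_comp:
  assumes "restriction_idempotent C (Dom C f) e" "f \<in> Arr C" "g \<in> Arr C" "h \<in> Arr C"
    "Dom C f = Dom C g" "Cod C f \<otimes> Cod C g = Dom C h" "e \<cdot> f = f" "e \<cdot> g = g"
  shows "e \<cdot> (\<langle>f, g\<rangle> \<cdot> h) = \<langle>f, g\<rangle> \<cdot> h"
  using assms by (simp add: restriction_idempotent_iff fixed_comp_left)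

text \<open>The idempotent moves to the other component, which absorbs it. In this way the
  idempotent on a zero map disappears once the zero is paired with a map of the splitting.\<close>

lemma pairing_fixed:
  assumes "restriction_idempotent C (Dom C f) e" "f \<in> Arr C" "e \<cdot> f = f"
    "g \<in> Arr C" "Dom C g = Dom C f"
  shows "\<langle>f, e \<cdot> g\<rangle> = \<langle>f, g\<rangle>" "\<langle>e \<cdot> g, f\<rangle> = \<langle>g, f\<rangle>"
proof -
  have e: "e \<in> Arr C" "Dom C e = Dom C f" "\<rho> e = e"
    using assms by (auto simp: restriction_idempotent_iff)
  have "\<langle>f, e \<cdot> g\<rangle> = e \<cdot> \<langle>f, g\<rangle>"
    using e(1,2) assms(2,4,5) by (intro pairing_rst_right [of f g e, unfolded e(3)]) simp_all
  also have "\<dots> = \<langle>e \<cdot> f, g\<rangle>"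
    using e(1,2) assms(2,4,5) by (intro pairing_rst_left [of f g e, unfolded e(3), symmetric]) simp_all
  finally show "\<langle>f, e \<cdot> g\<rangle> = \<langle>f, g\<rangle>"
    by (simp only: assms)
  have "\<langle>e \<cdot> g, f\<rangle> = e \<cdot> \<langle>g, f\<rangle>"
    using e(1,2) assms(2,4,5) by (intro pairing_rst_left [of g f e, unfolded e(3)]) simp_all
  also have "\<dots> = \<langle>g, e \<cdot> f\<rangle>"
    using e(1,2) assms(2,4,5) by (intro pairing_rst_right [of g f e, unfolded e(3), symmetric]) simp_all
  finally show "\<langle>e \<cdot> g, f\<rangle> = \<langle>g, f\<rangle>"
    by (simp only: assms)
qed

end

section \<open>The differential structure of the splitting\<close>

locale differential_splitting = restriction_idempotent_splitting C +
  generalized_differential_restriction_category C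
  for C :: "('o, 'a) gen_diff_restr_cat" (structure)
begin

declare L0_L0 [simp] Ladd_L0 [simp] Lzero_L0 [simp] L0_prod [simp] L0_unit [simp]
  Ladd_unit [simp] Lzero_unit [simp]

section \<open>Derivatives and restriction idempotents\<close>

lemma L_arr [simp]:
  assumes "X \<in> Obj C"
  shows "L0 X \<in> Obj C"
    and "\<alpha> X \<in> Arr C" "Dom C (\<alpha> X) = L0 X \<otimes> L0 X" "Cod C (\<alpha> X) = L0 X"
    and "\<zeta> X \<in> Arr C" "Dom C (\<zeta> X) = \<one>" "Cod C (\<zeta> X) = L0 X"
proof -
  interpret M: total_commutative_monoid C "L0 X" "\<alpha> X" "\<zeta> X"
    using assms by (rule L_monoid)
  show "L0 X \<in> Obj C" "\<alpha> X \<in> Arr C" "Dom C (\<alpha> X) = L0 X \<otimes> L0 X" "Cod C (\<alpha> X) = L0 X"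
    "\<zeta> X \<in> Arr C" "Dom C (\<zeta> X) = \<one>" "Cod C (\<zeta> X) = L0 X"
    using M.carrier_Obj M.add_hom M.zero_hom by (auto simp: hom_iff)
qed

lemma diff_arr [simp]:
  assumes "f \<in> Arr C"
  shows "\<partial> f \<in> Arr C" "Dom C (\<partial> f) = L0 (Dom C f) \<otimes> Dom C f" "Cod C (\<partial> f) = L0 (Cod C f)"
  using diff_hom [of f] assms by (simp_all add: hom_iff)

text \<open>By DR.9 the restriction of \<open>\<partial> f\<close> is that of
  \<open>\<pi>1 (L0 X) X \<cdot> f\<close>. Since \<open>f = e \<cdot> f\<close>, it absorbs the
  restriction of \<open>\<pi>1 (L0 X) X \<cdot> e\<close>, which is
  \<open>\<iota> (L0 X) \<odot> e\<close>.\<close>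

lemma diff_fixed:
  assumes "restriction_idempotent C X e" "f \<in> Arr C" "Dom C f = X" "e \<cdot> f = f"
  shows "(\<iota> (L0 X) \<odot> e) \<cdot> \<partial> f = \<partial> f"
proof -
  have e: "e \<in> Arr C" "Dom C e = X" "Cod C e = X" "X \<in> Obj C"
    using assms by (auto simp: restriction_idempotent_iff)
  have "\<rho> (\<pi>1 (L0 X) X \<cdot> e) \<cdot> \<rho> (\<pi>1 (L0 X) X \<cdot> f) = \<rho> (\<pi>1 (L0 X) X \<cdot> f)"
    using e assms rst_absorb [of "\<pi>1 (L0 X) X \<cdot> e" f] by simp
  then have *: "(\<iota> (L0 X) \<odot> e) \<cdot> \<rho> (\<partial> f) = \<rho> (\<partial> f)"
    using e assms DR9' [of f X "Cod C f"] by (simp add: idt_prod_map hom_iff)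
  have "(\<iota> (L0 X) \<odot> e) \<cdot> \<partial> f = ((\<iota> (L0 X) \<odot> e) \<cdot> \<rho> (\<partial> f)) \<cdot> \<partial> f"
    using e assms by simp
  also have "\<dots> = \<partial> f"
    using assms by (simp only: *) simp
  finally show ?thesis .
qed

text \<open>In DR.5 for \<open>e \<cdot> f\<close>, DR.8 and [R.4] present the two components as the
  projections restricted by the same idempotent \<open>\<rho> (\<pi>1 (L0 X) X \<cdot> e)\<close>.
  Pulled out of the pairing, it leaves an identity.\<close>

lemma diff_idempotent_comp:
  assumes "restriction_idempotent C X e" "f \<in> Arr C" "Dom C f = X"
  shows "\<partial> (e \<cdot> f) = (\<iota> (L0 X) \<odot> e) \<cdot> \<partial> f"
proof -
  have e: "e \<in> Arr C" "Dom C e = X" "Cod C e = X" "X \<in> Obj C" "\<rho> e = e"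
    using assms by (auto simp: restriction_idempotent_iff)
  have "\<partial> (e \<cdot> f) = \<langle>\<rho> (\<pi>1 (L0 X) X \<cdot> e) \<cdot> \<pi>0 (L0 X) X, \<rho> (\<pi>1 (L0 X) X \<cdot> e) \<cdot> \<pi>1 (L0 X) X\<rangle> \<cdot> \<partial> f"
    using e assms DR5 [of e X X f "Cod C f"] DR8' [of e X X] comp_rst [of "\<pi>1 (L0 X) X" e]
    by (simp add: hom_iff)
  also have "\<dots> = \<rho> (\<pi>1 (L0 X) X \<cdot> e) \<cdot> \<partial> f"
    using e assms by (simp add: pairing_rst_left pairing_rst_right)
  finally show ?thesis
    using e assms by (simp add: idt_prod_map)
qed

text \<open>DR.3 for the splitting on underlying maps: the right sides are the \<open>\<pi>0\<close>
  of the splitting followed by a projection between monoid carriers.\<close>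

lemma diff_proj_Kr:
  assumes "restriction_idempotent C X e" "restriction_idempotent C Y e'"
  shows "\<partial> ((e \<odot> e') \<cdot> \<pi>0 X Y) =
      (\<iota> (L0 X \<otimes> L0 Y) \<odot> (e \<odot> e')) \<cdot> (\<pi>0 (L0 X \<otimes> L0 Y) (X \<otimes> Y) \<cdot> \<pi>0 (L0 X) (L0 Y))" (is ?P1)
    "\<partial> ((e \<odot> e') \<cdot> \<pi>1 X Y) =
      (\<iota> (L0 X \<otimes> L0 Y) \<odot> (e \<odot> e')) \<cdot> (\<pi>0 (L0 X \<otimes> L0 Y) (X \<otimes> Y) \<cdot> \<pi>1 (L0 X) (L0 Y))" (is ?P2)
proof -
  have objs: "X \<in> Obj C" "Y \<in> Obj C"
    using assms by (auto simp: restriction_idempotent_iff)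
  show ?P1 ?P2
    using objs DR3_0 [OF objs] DR3_1 [OF objs]
      diff_idempotent_comp [OF restriction_idempotent_prod_map(1) [OF assms]]
    by simp_all
qed

section \<open>Underlying maps of the terms in the differential axioms\<close>

lemma zeroL_arr [simp]:
  assumes "W \<in> Obj C" "X \<in> Obj C"
  shows "zeroL C W X \<in> Arr C" "Dom C (zeroL C W X) = W" "Cod C (zeroL C W X) = L0 X"
  using assms by (simp_all add: zeroL_def)

lemma zeroL_Kr [simp]:
  assumes "restriction_idempotent C W d" "X \<in> Obj C"
  shows "zeroL (Kr C) (W, d) (X, e) = ((W, d), d \<cdot> zeroL C W X, (L0 X, \<iota> (L0 X)))"
proof -
  have "d \<in> Arr C" "Dom C d = W" "Cod C d = W" "W \<in> Obj C"
    using assms by (auto simp: restriction_idempotent_iff)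
  then show ?thesis
    using assms by (simp add: zeroL_def)
qed

lemma diff_Kr_Arr:
  assumes "((X, e), f, (Y, e')) \<in> Arr (Kr C)"
  shows "((L0 X \<otimes> X, \<iota> (L0 X) \<odot> e), \<partial> f, (L0 Y, \<iota> (L0 Y))) \<in> Arr (Kr C)"
  using assms
  by (auto simp: diff_fixed intro!: restriction_idempotent_prod_map(1))

lemma proj1_comp_Kr_Arr:
  assumes "((X, e), f, (Y, e')) \<in> Arr (Kr C)"
  shows "((L0 X \<otimes> X, \<iota> (L0 X) \<odot> e), \<pi>1 (L0 X) X \<cdot> f, (Y, e')) \<in> Arr (Kr C)"
  using assms restriction_idempotent_prod_map(1) [of "L0 X" "\<iota> (L0 X)" X e]
  by (auto simp: restriction_idempotent_iff [of Y e'])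

text \<open>The idempotent passes through \<open>\<pi>1\<close> as \<open>e\<close> and is absorbed
  by \<open>f\<close>. Hence the composite that occurs in DR.5, DR.8 and DR.9 is the one of
  \<open>C\<close>.\<close>

lemma proj1_comp_Kr:
  assumes "((X, e), f, (Y, e')) \<in> Arr (Kr C)"
  shows "((\<iota> (L0 X) \<odot> e) \<cdot> \<pi>1 (L0 X) X) \<cdot> f = \<pi>1 (L0 X) X \<cdot> f"
proof -
  have "restriction_idempotent C X e" "f \<in> Arr C" "Dom C f = X" "e \<cdot> f = f"
    "e \<in> Arr C" "Dom C e = X" "Cod C e = X" "X \<in> Obj C"
    using assms by (auto simp: restriction_idempotent_iff)
  then show ?thesis
    by simp
qed

text \<open>The two products compose to \<open>\<iota> (L0 X) \<odot> (\<rho> f \<cdot> e)\<close>,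
  and \<open>\<rho> f\<close> absorbs \<open>e\<close>. This and the next lemma serve the two forms
  of DR.8.\<close>

lemma prod_map_rst_Kr_proj0:
  assumes "((X, e), f, (Y, e')) \<in> Arr (Kr C)"
  shows "(\<iota> (L0 X) \<odot> \<rho> f) \<cdot> ((\<iota> (L0 X) \<odot> e) \<cdot> \<pi>0 (L0 X) X) = (\<iota> (L0 X) \<odot> \<rho> f) \<cdot> \<pi>0 (L0 X) X"
proof -
  have *: "restriction_idempotent C X e" "f \<in> Arr C" "Dom C f = X" "e \<cdot> f = f"
    "e \<in> Arr C" "Dom C e = X" "Cod C e = X" "X \<in> Obj C"
    using assms by (auto simp: restriction_idempotent_iff)
  then have "(\<iota> (L0 X) \<odot> \<rho> f) \<cdot> (\<iota> (L0 X) \<odot> e) = \<iota> (L0 X) \<odot> \<rho> f"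
    by (simp add: prod_map_comp fixed_rst del: prod_map_rst)
  then show ?thesis
    using * by (simp add: fixed_comp_right del: prod_map_rst)
qed

lemma rst_proj1_comp_Kr_proj0:
  assumes "((X, e), f, (Y, e')) \<in> Arr (Kr C)"
  shows "\<rho> (\<pi>1 (L0 X) X \<cdot> f) \<cdot> ((\<iota> (L0 X) \<odot> e) \<cdot> \<pi>0 (L0 X) X) =
    \<rho> (\<pi>1 (L0 X) X \<cdot> f) \<cdot> \<pi>0 (L0 X) X"
proof -
  have *: "f \<in> Arr C" "Dom C f = X" "X \<in> Obj C"
    using assms by auto
  then show ?thesis
    using prod_map_rst_Kr_proj0 [OF assms] idt_prod_map [of "L0 X" X "\<rho> f"]
    by (simp add: restriction_idempotent_iff)
qed

text \<open>These are the arguments of the second derivative in DR.6 and DR.7. Only the zero carries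
  an extra idempotent \<open>w\<close>, and the map \<open>a\<close> paired with it absorbs
  that.\<close>

lemma second_order_pairing_Kr:
  assumes "((W, w), a, (L0 X, \<iota> (L0 X))) \<in> Arr (Kr C)" "((W, w), c, (L0 X, \<iota> (L0 X))) \<in> Arr (Kr C)"
    "((W, w), d, (X, e)) \<in> Arr (Kr C)"
  shows "pairing (Kr C)
      (pairing (Kr C) ((W, w), a, (L0 X, \<iota> (L0 X))) ((W, w), w \<cdot> zeroL C W X, (L0 X, \<iota> (L0 X))))
      (pairing (Kr C) ((W, w), c, (L0 X, \<iota> (L0 X))) ((W, w), d, (X, e))) =
    ((W, w), \<langle>\<langle>a, zeroL C W X\<rangle>, \<langle>c, d\<rangle>\<rangle>,
      ((L0 X \<otimes> L0 X) \<otimes> (L0 X \<otimes> X), \<iota> (L0 X \<otimes> L0 X) \<odot> (\<iota> (L0 X) \<odot> e)))" (is ?P1)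
    and "pairing (Kr C)
      (pairing (Kr C) ((W, w), w \<cdot> zeroL C W X, (L0 X, \<iota> (L0 X))) ((W, w), a, (L0 X, \<iota> (L0 X))))
      (pairing (Kr C) ((W, w), c, (L0 X, \<iota> (L0 X))) ((W, w), d, (X, e))) =
    ((W, w), \<langle>\<langle>zeroL C W X, a\<rangle>, \<langle>c, d\<rangle>\<rangle>,
      ((L0 X \<otimes> L0 X) \<otimes> (L0 X \<otimes> X), \<iota> (L0 X \<otimes> L0 X) \<odot> (\<iota> (L0 X) \<odot> e)))" (is ?P2)
proof -
  have arr: "restriction_idempotent C W w" "restriction_idempotent C X e"
    "a \<in> Arr C" "Dom C a = W" "Cod C a = L0 X" "w \<cdot> a = a"
    "c \<in> Arr C" "Dom C c = W" "Cod C c = L0 X" "w \<cdot> c = c"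
    "d \<in> Arr C" "Dom C d = W" "Cod C d = X" "w \<cdot> d = d" "d \<cdot> e = d"
    using assms by auto
  then have e: "w \<in> Arr C" "Dom C w = W" "Cod C w = W" "e \<in> Arr C" "Dom C e = X" "Cod C e = X"
    "W \<in> Obj C" "X \<in> Obj C"
    by (auto simp: restriction_idempotent_iff)
  define z where "z = zeroL C W X"
  have z: "z \<in> Arr C" "Dom C z = W" "Cod C z = L0 X"
    using e by (simp_all add: z_def)
  have wz: "w \<cdot> (w \<cdot> z) = w \<cdot> z"
    using arr z idempotent_comp(4) [of z w] by simp
  have zero: "\<langle>a, w \<cdot> z\<rangle> = \<langle>a, z\<rangle>" "\<langle>w \<cdot> z, a\<rangle> = \<langle>z, a\<rangle>"
    using arr z pairing_fixed [of a w z] by auto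
  have fixed: "w \<cdot> \<langle>a, z\<rangle> = \<langle>a, z\<rangle>" "w \<cdot> \<langle>z, a\<rangle> = \<langle>z, a\<rangle>" "w \<cdot> \<langle>c, d\<rangle> = \<langle>c, d\<rangle>"
    using arr e z by (simp_all add: zero)
  have cd: "\<langle>c, d\<rangle> \<cdot> (\<iota> (L0 X) \<odot> e) = \<langle>c, d\<rangle>"
    using arr e by simp
  have "((W, w), w \<cdot> z, (L0 X, \<iota> (L0 X))) \<in> Arr (Kr C)"
    using arr e z wz by simp
  note inner = pairing_Kr [OF assms(1) this] pairing_Kr [OF this assms(1)]
    pairing_Kr [OF assms(2,3)]
  have "((W, w), \<langle>a, z\<rangle>, (L0 X \<otimes> L0 X, \<iota> (L0 X) \<odot> \<iota> (L0 X))) \<in> Arr (Kr C)"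
    "((W, w), \<langle>z, a\<rangle>, (L0 X \<otimes> L0 X, \<iota> (L0 X) \<odot> \<iota> (L0 X))) \<in> Arr (Kr C)"
    "((W, w), \<langle>c, d\<rangle>, (L0 X \<otimes> X, \<iota> (L0 X) \<odot> e)) \<in> Arr (Kr C)"
    using arr e z fixed cd
    by (simp_all add: restriction_idempotent_prod_map(1) del: comp_pairing pairing_prod_map)
  note outer = pairing_Kr [OF this(1) this(3)] pairing_Kr [OF this(2) this(3)]
  have "\<iota> (L0 X) \<odot> \<iota> (L0 X) = \<iota> (L0 X \<otimes> L0 X)"
    using e by simp
  then show ?P1 ?P2
    using inner outer zero by (simp_all only: z_def)
qed

section \<open>The axioms of a generalized differential restriction category for the
  splitting\<close>

lemma generalized_differential_restriction_category_Kr: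
  "generalized_differential_restriction_category (Kr C)"
proof (intro generalized_differential_restriction_category.intro cartesian_restriction_category_Kr
    generalized_differential_restriction_category_axioms.intro, goal_cases)
  note idem = restriction_idempotent_iff
  note prod = restriction_idempotent_prod_map(1)
  have obj: "X \<in> Obj C" if "restriction_idempotent C X e" for X e
    using that by (auto simp: idem)
  {
    \<comment> \<open>Cases 1 to 10 are the conditions on the monoids, 11 the typing of the
      derivative, and 12 to 25 the laws DR.1 to DR.9.\<close>
    case (1 X)
    then show ?case
      by (cases X) (auto simp: obj intro!: total_commutative_monoid_Kr L_monoid)
  next
    case (2 X)
    then show ?case by (cases X) (auto simp: obj)
  next
    case (3 X)
    then show ?case by (cases X) (auto simp: obj)
  next
    case (4 X)
    then show ?case by (cases X) (auto simp: obj)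
  next
    case (5 X Y)
    then show ?case by (cases X; cases Y) (auto simp: obj)
  next
    case (6 X Y)
    then show ?case using Ladd_prod by (cases X; cases Y) (auto simp: obj)
  next
    case (7 X Y)
    then show ?case using Lzero_prod by (cases X; cases Y) (auto simp: obj)
  next
    case 8
    then show ?case by simp
  next
    case 9
    then show ?case by simp
  next
    case 10
    then show ?case by simp
  next
    case (11 f X Y)
    then show ?case
      by (cases X; cases Y) (auto simp: Kr_hom_iff prod obj diff_fixed)
  next
    case (12 X)
    then show ?case using DR1_add by (cases X) (auto simp: obj)
  next
    case (13 X)
    then show ?case using DR1_zero by (cases X) (auto simp: obj)
  next
    case (14 f X Y a Z b c)
    then show ?case using DR2_add
      by (cases X; cases Y; cases Z)
        (auto simp: Kr_hom_iff prod obj diff_fixed hom_iff addL_def fixed_pairing_comp)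
  next
    case (15 f X Y a Z)
    then show ?case using DR2_zero
      by (cases X; cases Y; cases Z)
        (auto simp: Kr_hom_iff prod obj diff_fixed hom_iff pairing_fixed idempotent_comp rst_fixed_comp)
  next
    case (16 X Y)
    then show ?case by (cases X; cases Y) (auto simp: idem prod obj diff_proj_Kr)
  next
    case (17 X Y)
    then show ?case by (cases X; cases Y) (auto simp: idem prod obj diff_proj_Kr)
  next
    case (18 f Z X g Y)
    then show ?case using DR4
      by (cases X; cases Y; cases Z) (auto simp: Kr_hom_iff prod obj diff_fixed hom_iff)
  next
    case (19 f X Y g Z)
    then obtain X' e Y' e' Z' e'' f' g'
      where eqs: "X = (X', e)" "Y = (Y', e')" "Z = (Z', e'')"
        "f = ((X', e), f', (Y', e'))" "g = ((Y', e'), g', (Z', e''))"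
      and arr: "((X', e), f', (Y', e')) \<in> Arr (Kr C)" "((Y', e'), g', (Z', e'')) \<in> Arr (Kr C)"
      by (cases X; cases Y; cases Z) (simp add: Kr_hom_iff, blast)
    then have "X' \<in> Obj C" "Y' \<in> Obj C" "Z' \<in> Obj C"
      by (auto simp: obj)
    with eqs arr show ?case
      \<comment> \<open>The components of the pairing in DR.5 are maps of the splitting, so it is
        the pairing of \<open>C\<close>.\<close>
      using DR5 [of f' X' Y' g' Z'] pairing_Kr [OF diff_Kr_Arr proj1_comp_Kr_Arr, OF arr(1) arr(1)]
      by (simp add: hom_iff proj1_comp_Kr [OF arr(1)])
  next
    case (20 f X Y a W c d)
    then obtain X' e Y' e' W' w f' a' c' d'
      where eqs: "X = (X', e)" "Y = (Y', e')" "W = (W', w)"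
        "f = ((X', e), f', (Y', e'))" "a = ((W', w), a', (L0 X', \<iota> (L0 X')))"
        "c = ((W', w), c', (L0 X', \<iota> (L0 X')))" "d = ((W', w), d', (X', e))"
      and arr: "((X', e), f', (Y', e')) \<in> Arr (Kr C)"
        "((W', w), a', (L0 X', \<iota> (L0 X'))) \<in> Arr (Kr C)"
        "((W', w), c', (L0 X', \<iota> (L0 X'))) \<in> Arr (Kr C)" "((W', w), d', (X', e)) \<in> Arr (Kr C)"
      by (cases X; cases Y; cases W) (simp add: Kr_hom_iff, blast)
    then have "X' \<in> Obj C" "Y' \<in> Obj C" "W' \<in> Obj C"
      by (auto simp: obj)
    with eqs arr show ?case
      using DR6 [of f' X' Y' a' W' c' d'] second_order_pairing_Kr(1) [OF arr(2-4)]
      by (simp add: hom_iff)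
  next
    case (21 f X Y b W c d)
    then obtain X' e Y' e' W' w f' b' c' d'
      where eqs: "X = (X', e)" "Y = (Y', e')" "W = (W', w)"
        "f = ((X', e), f', (Y', e'))" "b = ((W', w), b', (L0 X', \<iota> (L0 X')))"
        "c = ((W', w), c', (L0 X', \<iota> (L0 X')))" "d = ((W', w), d', (X', e))"
      and arr: "((X', e), f', (Y', e')) \<in> Arr (Kr C)"
        "((W', w), b', (L0 X', \<iota> (L0 X'))) \<in> Arr (Kr C)"
        "((W', w), c', (L0 X', \<iota> (L0 X'))) \<in> Arr (Kr C)" "((W', w), d', (X', e)) \<in> Arr (Kr C)"
      by (cases X; cases Y; cases W) (simp add: Kr_hom_iff, blast)
    then have "X' \<in> Obj C" "Y' \<in> Obj C" "W' \<in> Obj C"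
      by (auto simp: obj)
    with eqs arr show ?case
      \<comment> \<open>The right side of DR.7 exchanges \<open>b\<close> and \<open>c\<close>,
        hence the second instance of the pairing formula with these two swapped.\<close>
      using DR7 [of f' X' Y' b' W' c' d'] second_order_pairing_Kr(2) [OF arr(2-4)]
        second_order_pairing_Kr(2) [OF arr(3,2,4)]
      by (simp add: hom_iff)
  next
    case (22 f X Y)
    then obtain X' e Y' e' f' where eqs: "X = (X', e)" "Y = (Y', e')" "f = ((X', e), f', (Y', e'))"
      and arr: "((X', e), f', (Y', e')) \<in> Arr (Kr C)"
      by (cases X; cases Y) (simp add: Kr_hom_iff, blast)
    then have "X' \<in> Obj C" "Y' \<in> Obj C"
      by (auto simp: obj)
    with eqs arr show ?case
      \<comment> \<open>The product form of the restriction is kept unexpanded below so that both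
        sides match DR.8.\<close>
      using DR8 [of f' X' Y'] fixed_rst [of X' e f'] prod_map_rst_Kr_proj0 [OF arr]
      by (simp add: hom_iff del: prod_map_rst)
  next
    case (23 f X Y)
    then obtain X' e Y' e' f' where eqs: "X = (X', e)" "Y = (Y', e')" "f = ((X', e), f', (Y', e'))"
      and arr: "((X', e), f', (Y', e')) \<in> Arr (Kr C)"
      by (cases X; cases Y) (simp add: Kr_hom_iff, blast)
    then have "X' \<in> Obj C" "Y' \<in> Obj C"
      by (auto simp: obj)
    with eqs arr show ?case
      using DR8' [of f' X' Y'] rst_proj1_comp_Kr_proj0 [OF arr]
      by (simp add: hom_iff proj1_comp_Kr [OF arr])
  next
    case (24 f X Y)
    then obtain X' e Y' e' f' where eqs: "X = (X', e)" "Y = (Y', e')" "f = ((X', e), f', (Y', e'))"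
      and arr: "((X', e), f', (Y', e')) \<in> Arr (Kr C)"
      by (cases X; cases Y) (simp add: Kr_hom_iff, blast)
    then have "X' \<in> Obj C" "Y' \<in> Obj C"
      by (auto simp: obj)
    with eqs arr show ?case
      using DR9 [of f' X' Y'] fixed_rst [of X' e f']
      by (simp add: hom_iff del: prod_map_rst)
  next
    case (25 f X Y)
    then obtain X' e Y' e' f' where eqs: "X = (X', e)" "Y = (Y', e')" "f = ((X', e), f', (Y', e'))"
      and arr: "((X', e), f', (Y', e')) \<in> Arr (Kr C)"
      by (cases X; cases Y) (simp add: Kr_hom_iff, blast)
    then have "X' \<in> Obj C" "Y' \<in> Obj C"
      by (auto simp: obj)
    with eqs arr show ?case
      using DR9' [of f' X' Y']
      by (simp add: hom_iff proj1_comp_Kr [OF arr])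
  }
qed

end

theorem proposition3p5:
  fixes C :: "('o, 'a) gen_diff_restr_cat"
  assumes "generalized_differential_restriction_category C"
  shows "generalized_differential_restriction_category (Kr C)"
proof -
  interpret generalized_differential_restriction_category C
    by (rule assms)
  interpret differential_splitting C
    by unfold_locales
  show ?thesis
    by (rule generalized_differential_restriction_category_Kr)
qed

end
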